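(* Let $P_{Y|X}$ be a discrete memoryless channel (DMC) with finite input alphabet $\mathcal{X}$ and finite output alphabet $\mathcal{Y}$, with capacity $C>0$. Assume there exists a capacity-achieving input distribution $P_X^*$ with $\min_{x\in\mathcal{X}}P_X^*(x)>0$, and assume $B<\infty$. Fix any family $\{\rho_N\}_{N\in\mathbb{R}_+}$ of positive reals with $\lim_{N\to\infty}\rho_N=0$ and $\lim_{N\to\infty}\rho_N\sqrt{N}=\infty$. Then the optimal moderate deviations constant satisfies $$E^*=\frac{B}{C}.$$
   Context: $C=\max_{P_X}I(X;Y)$ (in nats), and $B=\max_{x,x'\in\mathcal{X}}D(P_{Y|X}(\cdot|x)\,\|\,P_{Y|X}(\cdot|x'))$, where $D$ is relative entropy. An $(M,N)$-variable-length feedback (VLF) code, with $M$ a positive integer and $N>0$ real, consists of: a message $W$ uniform on $\mathcal{W}=\{1,\dots,M\}$; encoders $f_n:\mathcal{W}\times\mathcal{Y}^{n-1}\to\mathcal{X}$, $n\ge1$, producing channel inputs $X_n=f_n(W,Y^{n-1})$, where the channel output $Y_n$ is distributed as $P_{Y|X}(\cdot|X_n)$ conditionally on $(W,X^n,Y^{n-1})$; decoders $g_n:\mathcal{Y}^n\to\mathcal{W}$; and a stopping time $\tau$ of the filtration $\{\sigma(Y^n)\}_{n\ge0}$ with $\mathbb{E}(\tau)\le N$. The decoded message is $\hat W=g_\tau(Y^\tau)$ and the average error probability is $\mathsf{P}_{\mathrm e}(R_N,N)=\mathbb{P}(\hat W\ne W)$, where $R_N=\frac1N\ln M_N$. A number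 $E\ge0$ is an achievable moderate deviations constant (for the given family $\{\rho_N\}$) if there is a family, indexed by $N\in\mathbb{R}_+$, of $(M_N,N)$-VLF codes with $M_N=\exp(NR_N)$, $R_N\ge C-\rho_N$, $\lim_{N\to\infty}\mathsf{P}_{\mathrm e}(R_N,N)=0$, and $\liminf_{N\to\infty}-\frac{\ln\mathsf{P}_{\mathrm e}(R_N,N)}{N\rho_N}\ge E$. The optimal moderate deviations constant $E^*$ is the supremum of all achievable moderate deviations constants. *)

theory Defs
  imports Complex_Main "HOL-Library.Extended_Nonnegative_Real"
begin

definition is_dist :: "('a::finite \<Rightarrow> real) \<Rightarrow> bool" where
  "is_dist P \<longleftrightarrow> (\<forall>a. P a \<ge> 0) \<and> sum P UNIV = 1"

definition channel :: "('x::finite \<Rightarrow> 'y::finite \<Rightarrow> real) \<Rightarrow> bool" where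
  "channel W \<longleftrightarrow> (\<forall>x. is_dist (W x))"

definition out_dist :: "('x::finite \<Rightarrow> real) \<Rightarrow> ('x \<Rightarrow> 'y::finite \<Rightarrow> real) \<Rightarrow> 'y \<Rightarrow> real" where
  "out_dist P W y = (\<Sum>x\<in>UNIV. P x * W x y)"

definition mutual_info :: "('x::finite \<Rightarrow> real) \<Rightarrow> ('x \<Rightarrow> 'y::finite \<Rightarrow> real) \<Rightarrow> real" where
  "mutual_info P W = (\<Sum>x\<in>UNIV. \<Sum>y\<in>UNIV.
      if P x * W x y = 0 then 0 else P x * W x y * ln (W x y / out_dist P W y))"

definition capacity :: "('x::finite \<Rightarrow> 'y::finite \<Rightarrow> real) \<Rightarrow> real" where
  "capacity W = Sup {mutual_info P W | P. is_dist P}"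

definition rel_entropy :: "('y::finite \<Rightarrow> real) \<Rightarrow> ('y \<Rightarrow> real) \<Rightarrow> ereal" where
  "rel_entropy p q = (if \<exists>y. p y > 0 \<and> q y = 0 then \<infinity>
      else ereal (\<Sum>y\<in>UNIV. if p y = 0 then 0 else p y * ln (p y / q y)))"

definition maxKL :: "('x::finite \<Rightarrow> 'y::finite \<Rightarrow> real) \<Rightarrow> ereal" where
  "maxKL W = Max {rel_entropy (W x) (W x') | x x'. True}"

text \<open>VLF codes.  Messages are 1..M.  The encoder enc w ys gives the input
X_{n} = f_n(w, y^{n-1}) where ys = y^{n-1} (so n = length ys + 1).  The decoder
dec ys = g_n(y^n) with n = length ys.  The stopping time is represented by a
predicate stop on output strings: \<tau> = least n such that stop (y^n); every stopping
time of the filtration (\<sigma>(Y^n))_{n\<ge>0} arises this way.\<close>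

definition out_prob :: "('x \<Rightarrow> 'y \<Rightarrow> real) \<Rightarrow> (nat \<Rightarrow> 'y list \<Rightarrow> 'x) \<Rightarrow> nat \<Rightarrow> 'y list \<Rightarrow> real" where
  "out_prob W enc w ys = (\<Prod>i<length ys. W (enc w (take i ys)) (ys ! i))"

definition stops_at :: "('y list \<Rightarrow> bool) \<Rightarrow> 'y list \<Rightarrow> bool" where
  "stops_at stop ys \<longleftrightarrow> stop ys \<and> (\<forall>k<length ys. \<not> stop (take k ys))"

definition survives :: "('y list \<Rightarrow> bool) \<Rightarrow> 'y list \<Rightarrow> bool" where
  "survives stop ys \<longleftrightarrow> (\<forall>k\<le>length ys. \<not> stop (take k ys))"

definition prob_tau_gt :: "('x \<Rightarrow> 'y::finite \<Rightarrow> real) \<Rightarrow> nat \<Rightarrow> (nat \<Rightarrow> 'y list \<Rightarrow> 'x)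
    \<Rightarrow> ('y list \<Rightarrow> bool) \<Rightarrow> nat \<Rightarrow> real" where
  "prob_tau_gt W M enc stop n = (\<Sum>w\<in>{1..M}. \<Sum>ys\<in>{ys. length ys = n}.
      if survives stop ys then out_prob W enc w ys / real M else 0)"

text \<open>E(\<tau>) = \<Sum>_{n\<ge>0} P(\<tau> > n)  (equal to \<infinity> if P(\<tau> = \<infinity>) > 0).\<close>
definition exp_tau :: "('x \<Rightarrow> 'y::finite \<Rightarrow> real) \<Rightarrow> nat \<Rightarrow> (nat \<Rightarrow> 'y list \<Rightarrow> 'x)
    \<Rightarrow> ('y list \<Rightarrow> bool) \<Rightarrow> ennreal" where
  "exp_tau W M enc stop = (\<Sum>n. ennreal (prob_tau_gt W M enc stop n))"

definition err_prob :: "('x \<Rightarrow> 'y::finite \<Rightarrow> real) \<Rightarrow> nat \<Rightarrow> (nat \<Rightarrow> 'y list \<Rightarrow> 'x)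
    \<Rightarrow> ('y list \<Rightarrow> bool) \<Rightarrow> ('y list \<Rightarrow> nat) \<Rightarrow> real" where
  "err_prob W M enc stop dec = (\<Sum>n. \<Sum>w\<in>{1..M}. \<Sum>ys\<in>{ys. length ys = n}.
      if stops_at stop ys \<and> dec ys \<noteq> w then out_prob W enc w ys / real M else 0)"

definition is_VLF_code :: "('x \<Rightarrow> 'y::finite \<Rightarrow> real) \<Rightarrow> nat \<Rightarrow> real \<Rightarrow> (nat \<Rightarrow> 'y list \<Rightarrow> 'x)
    \<Rightarrow> ('y list \<Rightarrow> bool) \<Rightarrow> ('y list \<Rightarrow> nat) \<Rightarrow> bool" where
  "is_VLF_code W M N enc stop dec \<longleftrightarrow>
     M \<ge> 1 \<and> N > 0 \<and> (\<forall>ys. dec ys \<in> {1..M}) \<and> exp_tau W M enc stop \<le> ennreal N"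

definition neg_ln :: "real \<Rightarrow> ereal" where
  "neg_ln p = (if p = 0 then \<infinity> else ereal (- ln p))"

definition achievable_md :: "('x::finite \<Rightarrow> 'y::finite \<Rightarrow> real) \<Rightarrow> (real \<Rightarrow> real) \<Rightarrow> real \<Rightarrow> bool" where
  "achievable_md W \<rho> E \<longleftrightarrow> E \<ge> 0 \<and>
    (\<exists>(Mf :: real \<Rightarrow> nat) (enc :: real \<Rightarrow> nat \<Rightarrow> 'y list \<Rightarrow> 'x) stop dec.
      (\<forall>N>0. is_VLF_code W (Mf N) N (enc N) (stop N) (dec N)
             \<and> ln (real (Mf N)) / N \<ge> capacity W - \<rho> N)
    \<and> ((\<lambda>N. err_prob W (Mf N) (enc N) (stop N) (dec N)) \<longlongrightarrow> 0) at_top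
    \<and> Liminf at_top (\<lambda>N. neg_ln (err_prob W (Mf N) (enc N) (stop N) (dec N)) / ereal (N * \<rho> N))
        \<ge> ereal E)"

definition optimal_md :: "('x::finite \<Rightarrow> 'y::finite \<Rightarrow> real) \<Rightarrow> (real \<Rightarrow> real) \<Rightarrow> ereal" where
  "optimal_md W \<rho> = Sup (ereal ` {E. achievable_md W \<rho> E})"

end

theory Submission
  imports Defs
begin

text \<open>
Let \<open>p\<^sub>w\<close> be the unnormalised posterior weight of message \<open>w\<close>, \<open>T = \<Sum>w. p\<^sub>w\<close>, and let
\<open>L\<^sub>w = ln (p\<^sub>w / (T - p\<^sub>w))\<close> be its log-odds.  Under message \<open>w\<close> the drift of \<open>L\<^sub>w\<close> is the divergence
from the output law of the signal of \<open>w\<close> to the mixture of the laws for the other messages, and its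
increments are bounded by a constant \<open>K\<close> because \<open>B < \<infinity>\<close>.

Achievability.  Stop as soon as some \<open>L\<^sub>w\<close> reaches \<open>b\<close>, so that the error is at most \<open>exp (-b)\<close>.  If
every \<open>L\<^sub>w\<close> is below \<open>a\<close>, signals drawn independently from the capacity-achieving law have average
drift at least \<open>C\<close> by convexity, hence so does some deterministic choice; otherwise the leading message
sends the first and all others the second of two inputs at divergence \<open>B\<close>.  The potential \<open>E f(L\<^sub>W)\<close>,
for \<open>f\<close> concave with slope \<open>1/C\<close> below \<open>a\<close> that decreases to \<open>1/B\<close> on a scale \<open>R\<close>, then
gains \<open>1 - exp (-a) - K\<^sup>2/(C R)\<close> per channel use.  With \<open>a = R = sqrt N\<close> all losses are \<open>O(sqrt N)\<close>,
which is \<open>o(N \<rho>\<^sub>N)\<close> exactly because \<open>\<rho>\<^sub>N sqrt N \<rightarrow> \<infinity>\<close>.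

Converse.  The posterior entropy falls by at most \<open>C\<close> per channel use and the posterior mean of the
log-odds rises by at most \<open>B\<close>.  Use the former until some posterior probability first reaches
\<open>1 - \<delta>\<close> and the latter from then on.  At that time the log-odds are still at most of order
\<open>ln (1/\<delta>)\<close>, whereas at the end their mean is about \<open>- ln P\<^sub>e\<close>.  With \<open>\<delta> = 1/N\<close> the correction
terms are \<open>O(ln N)\<close>.
\<close>

section \<open>Optional stopping on output strings\<close>

text \<open>Every \<open>F\<close> used below carries the unnormalised weight of its output string,
  so \<open>surv_sum\<close> and \<open>stop_sum\<close> are, up to the factor \<open>M\<close>,
  expectations over the events that the stopping time exceeds \<open>n\<close> and equals
  \<open>n\<close>.\<close>

definition surv_sum :: "('y::finite list \<Rightarrow> bool) \<Rightarrow> nat \<Rightarrow> ('y list \<Rightarrow> real) \<Rightarrow> real" where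
  "surv_sum stop n F = (\<Sum>ys\<in>{ys. length ys = n}. if survives stop ys then F ys else 0)"

definition stop_sum :: "('y::finite list \<Rightarrow> bool) \<Rightarrow> nat \<Rightarrow> ('y list \<Rightarrow> real) \<Rightarrow> real" where
  "stop_sum stop n F = (\<Sum>ys\<in>{ys. length ys = n}. if stops_at stop ys then F ys else 0)"

lemma sum_lists_Suc:
  "(\<Sum>ys\<in>{ys :: 'y::finite list. length ys = Suc n}. F ys)
    = (\<Sum>ys\<in>{ys. length ys = n}. \<Sum>y\<in>UNIV. F (ys @ [y]) :: real)"
proof -
  have "(\<Sum>ys\<in>{ys. length ys = n}. \<Sum>y\<in>UNIV. F (ys @ [y]))
      = (\<Sum>(ys, y)\<in>{ys. length ys = n} \<times> UNIV. F (ys @ [y]))"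
    by (simp add: sum.cartesian_product)
  also have "\<dots> = (\<Sum>ys\<in>{ys. length ys = Suc n}. F ys)"
  proof (rule sum.reindex_bij_witness[of _ "\<lambda>ys. (butlast ys, last ys)" "\<lambda>(ys, y). ys @ [y]"])
    fix ys :: "'y list"
    assume ys: "ys \<in> {ys. length ys = Suc n}"
    then have "ys \<noteq> []" by auto
    then show "(case (butlast ys, last ys) of (zs, y) \<Rightarrow> zs @ [y]) = ys"
      by simp
    show "(butlast ys, last ys) \<in> {ys. length ys = n} \<times> UNIV"
      using ys by simp
  qed auto
  finally show ?thesis by simp
qed

lemma survives_Nil: "survives stop [] \<longleftrightarrow> \<not> stop []"
  by (simp add: survives_def)

lemma stops_at_Nil: "stops_at stop [] \<longleftrightarrow> stop []"
  by (simp add: stops_at_def)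

lemma all_take_snoc:
  "(\<forall>k<length (ys @ [y]). \<not> stop (take k (ys @ [y]))) \<longleftrightarrow> survives stop ys"
  by (auto simp: survives_def less_Suc_eq_le)

lemma survives_snoc: "survives stop (ys @ [y]) \<longleftrightarrow> survives stop ys \<and> \<not> stop (ys @ [y])"
proof -
  have "survives stop (ys @ [y]) \<longleftrightarrow>
      (\<forall>k<length (ys @ [y]). \<not> stop (take k (ys @ [y]))) \<and> \<not> stop (ys @ [y])"
    unfolding survives_def by (metis order_le_less take_all_iff)
  then show ?thesis by (simp only: all_take_snoc)
qed

lemma stops_at_snoc: "stops_at stop (ys @ [y]) \<longleftrightarrow> survives stop ys \<and> stop (ys @ [y])"
  unfolding stops_at_def all_take_snoc by blast

lemma surv_sum_mono:
  assumes "\<And>ys. survives stop ys \<Longrightarrow> F ys \<le> G ys"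
  shows "surv_sum stop n F \<le> surv_sum stop n G"
  unfolding surv_sum_def by (rule sum_mono) (simp add: assms)

lemma stop_sum_mono:
  assumes "\<And>ys. stops_at stop ys \<Longrightarrow> F ys \<le> G ys"
  shows "stop_sum stop n F \<le> stop_sum stop n G"
  unfolding stop_sum_def by (rule sum_mono) (simp add: assms)

lemma surv_sum_cmult: "surv_sum stop n (\<lambda>ys. c * F ys) = c * surv_sum stop n F"
  unfolding surv_sum_def sum_distrib_left by (rule sum.cong) auto

lemma stop_sum_cmult: "stop_sum stop n (\<lambda>ys. c * F ys) = c * stop_sum stop n F"
  unfolding stop_sum_def sum_distrib_left by (rule sum.cong) auto

lemma stop_sum_add:
  "stop_sum stop n (\<lambda>ys. F ys + G ys) = stop_sum stop n F + stop_sum stop n G"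
  unfolding stop_sum_def sum.distrib[symmetric] by (rule sum.cong) auto

lemma surv_sum_nonneg: "(\<And>ys. F ys \<ge> 0) \<Longrightarrow> surv_sum stop n F \<ge> 0"
  unfolding surv_sum_def by (rule sum_nonneg) simp

lemma stop_sum_nonneg: "(\<And>ys. F ys \<ge> 0) \<Longrightarrow> stop_sum stop n F \<ge> 0"
  unfolding stop_sum_def by (rule sum_nonneg) simp

text \<open>A one-letter extension of a surviving string either survives or stops, and strings of
  length \<open>Suc n\<close> that do either arise in no other way.\<close>

lemma surv_stop_step:
  "surv_sum stop (Suc n) F + stop_sum stop (Suc n) F
    = surv_sum stop n (\<lambda>ys. \<Sum>y\<in>UNIV. F (ys @ [y]))"
  unfolding surv_sum_def stop_sum_def sum.distrib[symmetric] sum_lists_Suc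
  by (intro sum.cong refl) (auto simp: survives_snoc stops_at_snoc intro!: sum.cong)

text \<open>The one-step identity telescopes. Truncation at time \<open>n\<close> keeps every sum
  finite, so integrability never enters; the limit in \<open>n\<close> is left to the
  applications.\<close>

lemma optional_stopping:
  "surv_sum stop n F + (\<Sum>k\<le>n. stop_sum stop k F)
    = F [] + (\<Sum>k<n. surv_sum stop k (\<lambda>ys. (\<Sum>y\<in>UNIV. F (ys @ [y])) - F ys))"
proof (induction n)
  case 0
  have "{ys :: 'a list. length ys = 0} = {[]}" by auto
  then have "(\<Sum>ys\<in>{ys :: 'a list. length ys = 0}. G ys) = G []" for G :: "'a list \<Rightarrow> real"
    by (simp only:) simp
  then show ?case
    by (simp only: surv_sum_def stop_sum_def lessThan_0 atMost_0 sum.empty)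
       (simp add: survives_Nil stops_at_Nil)
next
  case (Suc n)
  have "surv_sum stop n (\<lambda>ys. (\<Sum>y\<in>UNIV. F (ys @ [y])) - F ys)
      = surv_sum stop n (\<lambda>ys. \<Sum>y\<in>UNIV. F (ys @ [y])) - surv_sum stop n F"
    unfolding surv_sum_def sum_subtractf[symmetric] by (rule sum.cong) auto
  then show ?case
    using Suc surv_stop_step[of stop n F] by simp
qed

lemma optional_stopping_le:
  assumes "\<And>ys. survives stop ys \<Longrightarrow> (\<Sum>y\<in>UNIV. F (ys @ [y])) - F ys \<le> G ys"
  shows "surv_sum stop n F + (\<Sum>k\<le>n. stop_sum stop k F) \<le> F [] + (\<Sum>k<n. surv_sum stop k G)"
  unfolding optional_stopping using assms
  by (intro add_left_mono sum_mono surv_sum_mono) auto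

lemma optional_stopping_ge:
  assumes "\<And>ys. survives stop ys \<Longrightarrow> G ys \<le> (\<Sum>y\<in>UNIV. F (ys @ [y])) - F ys"
  shows "F [] + (\<Sum>k<n. surv_sum stop k G) \<le> surv_sum stop n F + (\<Sum>k\<le>n. stop_sum stop k F)"
  unfolding optional_stopping using assms
  by (intro add_left_mono sum_mono surv_sum_mono) auto

lemma optional_stopping_eq:
  assumes "\<And>ys. (\<Sum>y\<in>UNIV. F (ys @ [y])) = F ys"
  shows "surv_sum stop n F + (\<Sum>k\<le>n. stop_sum stop k F) = F []"
  unfolding optional_stopping by (simp add: assms surv_sum_def)

section \<open>Likelihoods, stopping time and error probability as sums over output strings\<close>

lemma out_prob_Nil: "out_prob W enc w [] = 1"
  by (simp add: out_prob_def)

lemma out_prob_snoc: "out_prob W enc w (ys @ [y]) = out_prob W enc w ys * W (enc w ys) y"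
  unfolding out_prob_def by (simp add: nth_append)

lemma prob_tau_gt_eq:
  "prob_tau_gt W M enc stop n
    = surv_sum stop n (\<lambda>ys. \<Sum>w\<in>{1..M}. out_prob W enc w ys) / real M"
  unfolding prob_tau_gt_def surv_sum_def sum_divide_distrib
  by (subst sum.swap) (auto intro!: sum.cong simp: sum_divide_distrib)

text \<open>Given the output string, the error mass is the weight of all messages except the decoded
  one; exchanging the finite sums collects it string by string.\<close>

lemma err_prob_eq:
  assumes "\<And>ys. dec ys \<in> {1..M}"
  shows "err_prob W M enc stop dec
    = (\<Sum>n. stop_sum stop n (\<lambda>ys. \<Sum>w\<in>{1..M} - {dec ys}. out_prob W enc w ys) / real M)"
proof -
  have "(\<Sum>w\<in>{1..M}. \<Sum>ys\<in>{ys. length ys = n}.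
      if stops_at stop ys \<and> dec ys \<noteq> w then out_prob W enc w ys / real M else 0)
    = stop_sum stop n (\<lambda>ys. \<Sum>w\<in>{1..M} - {dec ys}. out_prob W enc w ys) / real M" for n
  proof -
    have *: "(\<Sum>w\<in>{1..M} - {d}. f w / real M) = (\<Sum>w\<in>{1..M}. if d \<noteq> w then f w / real M else 0)"
      for d and f :: "nat \<Rightarrow> real"
      by (rule sum.mono_neutral_cong_left) auto
    have "(\<Sum>w\<in>{1..M}. if stops_at stop ys \<and> dec ys \<noteq> w then out_prob W enc w ys / real M else 0)
      = (if stops_at stop ys then \<Sum>w\<in>{1..M} - {dec ys}. out_prob W enc w ys else 0) / real M" for ys
      by (cases "stops_at stop ys")
         (simp_all add: sum_divide_distrib *[symmetric, of "dec ys" "\<lambda>w. out_prob W enc w ys", simplified])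
    then show ?thesis
      unfolding stop_sum_def by (subst sum.swap) (simp only: sum_divide_distrib)
  qed
  then show ?thesis unfolding err_prob_def by simp
qed

section \<open>Relative entropy and mixtures of channel laws\<close>

text \<open>Real-valued divergence. It agrees with \<open>rel_entropy\<close> as long as
  \<open>q\<close> vanishes only where \<open>p\<close> does.\<close>

definition kl :: "('y::finite \<Rightarrow> real) \<Rightarrow> ('y \<Rightarrow> real) \<Rightarrow> real" where
  "kl p q = (\<Sum>y\<in>UNIV. p y * ln (p y / q y))"

definition mixture :: "('x \<Rightarrow> 'y \<Rightarrow> real) \<Rightarrow> 'i set \<Rightarrow> ('i \<Rightarrow> real) \<Rightarrow> ('i \<Rightarrow> 'x) \<Rightarrow> 'y \<Rightarrow> real" where
  "mixture W A a \<gamma> y = (\<Sum>j\<in>A. a j * W (\<gamma> j) y) / sum a A"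

lemma ln_ge_one_minus: "x > 0 \<Longrightarrow> ln (x::real) \<ge> 1 - 1 / x"
  using ln_le_minus_one[of "1/x"] by (simp add: ln_div)

lemma kl_nonneg:
  fixes p q :: "'y::finite \<Rightarrow> real"
  assumes "\<And>y. p y \<ge> 0" "\<And>y. p y > 0 \<Longrightarrow> q y > 0" "\<And>y. q y \<ge> 0"
    and "sum p UNIV = 1" "sum q UNIV \<le> 1"
  shows "kl p q \<ge> 0"
proof -
  have "p y - q y \<le> p y * ln (p y / q y)" for y
  proof (cases "p y = 0")
    case False
    then have p: "p y > 0" using assms(1)[of y] by linarith
    then have q: "q y > 0" by (rule assms(2))
    have "1 - 1 / (p y / q y) \<le> ln (p y / q y)"
      using p q by (intro ln_ge_one_minus) simp
    then have "p y * (1 - 1 / (p y / q y)) \<le> p y * ln (p y / q y)"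
      using p by (intro mult_left_mono) auto
    then show ?thesis using p q by (simp add: right_diff_distrib)
  qed (simp add: assms(3))
  then have "(\<Sum>y\<in>UNIV. p y - q y) \<le> kl p q"
    unfolding kl_def by (rule sum_mono)
  then show ?thesis using assms(4,5) by (simp add: sum_subtractf)
qed

text \<open>\<open>full\<close> makes all channel laws share one support, which is what finiteness
  of the largest divergence means. Likelihood ratios on that support are then bounded.\<close>

locale regular_channel =
  fixes W :: "'x::finite \<Rightarrow> 'y::finite \<Rightarrow> real"
  assumes channel: "channel W"
    and full: "W x y > 0 \<Longrightarrow> W x' y > 0"
begin

lemma W_nonneg: "W x y \<ge> 0"
  using channel by (simp add: channel_def is_dist_def)

lemma W_sum: "(\<Sum>y\<in>UNIV. W x y) = 1"
  using channel by (simp add: channel_def is_dist_def)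

definition B :: real where
  "B = Max (range (\<lambda>(x, x'). kl (W x) (W x')))"

text \<open>One bound for all log-likelihood ratios. A sum is cruder than a maximum, but any finite
  constant will do.\<close>

definition K :: real where
  "K = (\<Sum>(x, x', y)\<in>UNIV. \<bar>ln (W x y / W x' y)\<bar>)"

lemma K_nonneg: "K \<ge> 0"
  unfolding K_def by (intro sum_nonneg) auto

lemma W_ratio: "W x y \<le> exp K * W x' y"
proof (cases "W x y = 0")
  case False
  then have p: "W x y > 0" "W x' y > 0"
    using W_nonneg[of x y] full[of x y x'] by linarith+
  have "(case (x, x', y) of (x, x', y) \<Rightarrow> \<bar>ln (W x y / W x' y)\<bar>) \<le> K"
    unfolding K_def by (rule member_le_sum) auto
  then have "ln (W x y / W x' y) \<le> K" by simp
  then have "W x y / W x' y \<le> exp K"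
    using p by (metis divide_pos_pos exp_le_cancel_iff exp_ln)
  then show ?thesis using p by (simp add: field_simps)
qed (simp add: W_nonneg)

lemma kl_le_B: "kl (W x) (W x') \<le> B"
proof -
  have "(case (x, x') of (x, x') \<Rightarrow> kl (W x) (W x')) \<le> B"
    unfolding B_def by (rule Max_ge) auto
  then show ?thesis by simp
qed

lemma B_attained: "\<exists>x x'. kl (W x) (W x') = B"
proof -
  have "B \<in> range (\<lambda>(x, x'). kl (W x) (W x'))"
    unfolding B_def by (rule Max_in) auto
  then obtain x x' where "B = kl (W x) (W x')" by auto
  then show ?thesis by metis
qed

lemma mixture_bounds:
  assumes "finite A" "\<And>j. j \<in> A \<Longrightarrow> a j \<ge> 0" "sum a A > 0"
  shows "mixture W A a \<gamma> y \<le> exp K * W x y" "W x y \<le> exp K * mixture W A a \<gamma> y"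
proof -
  have "(\<Sum>j\<in>A. a j * W (\<gamma> j) y) \<le> (\<Sum>j\<in>A. a j * (exp K * W x y))"
    by (intro sum_mono mult_left_mono W_ratio assms)
  then show "mixture W A a \<gamma> y \<le> exp K * W x y"
    using assms(3) unfolding mixture_def
    by (simp add: sum_distrib_right[symmetric] field_simps)
  have "(\<Sum>j\<in>A. a j * W x y) \<le> (\<Sum>j\<in>A. a j * (exp K * W (\<gamma> j) y))"
    by (intro sum_mono mult_left_mono W_ratio assms)
  also have "\<dots> = exp K * (\<Sum>j\<in>A. a j * W (\<gamma> j) y)"
    by (simp add: sum_distrib_left algebra_simps)
  finally show "W x y \<le> exp K * mixture W A a \<gamma> y"
    using assms(3) unfolding mixture_def
    by (simp add: sum_distrib_right[symmetric] field_simps)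
qed

lemma mixture_nonneg:
  assumes "finite A" "\<And>j. j \<in> A \<Longrightarrow> a j \<ge> 0" "sum a A > 0"
  shows "mixture W A a \<gamma> y \<ge> 0"
  unfolding mixture_def using assms by (intro divide_nonneg_pos sum_nonneg mult_nonneg_nonneg W_nonneg) auto

lemma mixture_pos:
  assumes "finite A" "\<And>j. j \<in> A \<Longrightarrow> a j \<ge> 0" "sum a A > 0" "W x y > 0"
  shows "mixture W A a \<gamma> y > 0"
proof -
  have "0 < exp K * mixture W A a \<gamma> y"
    using mixture_bounds(2)[OF assms(1-3), of x y \<gamma>] assms(4) by linarith
  then show ?thesis by (simp add: zero_less_mult_iff)
qed

lemma mixture_sum:
  assumes "finite A" "sum a A > 0"
  shows "(\<Sum>y\<in>UNIV. mixture W A a \<gamma> y) = 1"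
proof -
  have "(\<Sum>y\<in>UNIV. \<Sum>j\<in>A. a j * W (\<gamma> j) y) = sum a A"
    by (subst sum.swap) (simp add: sum_distrib_left[symmetric] W_sum)
  then show ?thesis
    using assms(2) unfolding mixture_def by (simp add: sum_divide_distrib[symmetric])
qed

lemma kl_mixture_nonneg:
  assumes "finite A" "\<And>j. j \<in> A \<Longrightarrow> a j \<ge> 0" "sum a A > 0"
  shows "kl (W x) (mixture W A a \<gamma>) \<ge> 0"
  using mixture_pos[OF assms] mixture_sum[OF assms(1,3)] mixture_nonneg[OF assms]
  by (intro kl_nonneg) (auto simp: W_nonneg W_sum)

text \<open>One channel use changes a log-odds by exactly such a logarithm, so \<open>K\<close>
  bounds the increments of the log-odds.\<close>

lemma abs_ln_mixture_le:
  assumes "finite A" "\<And>j. j \<in> A \<Longrightarrow> a j \<ge> 0" "sum a A > 0" "W x y > 0"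
  shows "\<bar>ln (W x y / mixture W A a \<gamma> y)\<bar> \<le> K"
proof -
  note m = mixture_pos[OF assms, of \<gamma>]
  have "ln (mixture W A a \<gamma> y) \<le> ln (exp K * W x y)"
    using m mixture_bounds(1)[OF assms(1-3)] by (intro ln_mono) auto
  moreover have "ln (W x y) \<le> ln (exp K * mixture W A a \<gamma> y)"
    using assms(4) mixture_bounds(2)[OF assms(1-3)] by (intro ln_mono) auto
  ultimately show ?thesis
    using m assms(4) by (simp add: ln_mult ln_div abs_le_iff)
qed

text \<open>Convexity of relative entropy in its second argument, via the tangent line of the logarithm
  at the mixture.\<close>

lemma kl_mixture_le:
  assumes "finite A" "\<And>j. j \<in> A \<Longrightarrow> a j \<ge> 0" "sum a A > 0"
  shows "kl (W x) (mixture W A a \<gamma>) \<le> B"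
proof -
  let ?m = "mixture W A a \<gamma>"
  have pt: "sum a A * (W x y * ln (W x y / ?m y)) \<le> (\<Sum>j\<in>A. a j * (W x y * ln (W x y / W (\<gamma> j) y)))"
    for y
  proof (cases "W x y = 0")
    case False
    then have p: "W x y > 0" and pj: "W (\<gamma> j) y > 0" for j
      using W_nonneg[of x y] full[of x y] by (auto simp: less_le)
    note m = mixture_pos[OF assms p, of \<gamma>]
    have "(\<Sum>j\<in>A. a j * (ln (W (\<gamma> j) y) - ln (?m y))) \<le> (\<Sum>j\<in>A. a j * (W (\<gamma> j) y / ?m y - 1))"
    proof (intro sum_mono mult_left_mono assms)
      fix j
      show "ln (W (\<gamma> j) y) - ln (?m y) \<le> W (\<gamma> j) y / ?m y - 1"
        using ln_le_minus_one[of "W (\<gamma> j) y / ?m y"] pj[of j] m by (simp add: ln_div)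
    qed
    also have "\<dots> = (\<Sum>j\<in>A. a j * W (\<gamma> j) y) / ?m y - sum a A"
      by (simp add: algebra_simps sum_subtractf sum_divide_distrib)
    also have "\<dots> = 0"
      using assms(3) m unfolding mixture_def by (auto simp: field_simps)
    finally have "(\<Sum>j\<in>A. a j * (ln (W (\<gamma> j) y) - ln (?m y))) \<le> 0" .
    then have "W x y * (\<Sum>j\<in>A. a j * (ln (W (\<gamma> j) y) - ln (?m y))) \<le> 0"
      using p by (simp add: mult_le_0_iff)
    moreover have "(\<Sum>j\<in>A. a j * (W x y * ln (W x y / W (\<gamma> j) y)))
        = sum a A * (W x y * ln (W x y / ?m y))
          - W x y * (\<Sum>j\<in>A. a j * (ln (W (\<gamma> j) y) - ln (?m y)))"
      unfolding sum_distrib_right sum_distrib_left sum_subtractf[symmetric]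
      using p pj[THEN less_imp_neq, symmetric] m by (intro sum.cong refl) (simp add: ln_div algebra_simps)
    ultimately show ?thesis by linarith
  qed simp
  have "sum a A * kl (W x) ?m \<le> (\<Sum>y\<in>UNIV. \<Sum>j\<in>A. a j * (W x y * ln (W x y / W (\<gamma> j) y)))"
    unfolding kl_def sum_distrib_left using pt by (intro sum_mono)
  also have "\<dots> = (\<Sum>j\<in>A. a j * kl (W x) (W (\<gamma> j)))"
    by (subst sum.swap) (simp add: kl_def sum_distrib_left)
  also have "\<dots> \<le> (\<Sum>j\<in>A. a j * B)"
    by (intro sum_mono mult_left_mono kl_le_B assms)
  finally have "sum a A * kl (W x) ?m \<le> sum a A * B"
    by (simp add: sum_distrib_right)
  then show ?thesis using assms(3) by simp
qed

section \<open>Mutual information and capacity\<close>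

lemma out_dist_mixture: "is_dist P \<Longrightarrow> out_dist P W = mixture W UNIV P id"
  by (rule ext) (simp add: out_dist_def mixture_def is_dist_def)

lemma mutual_info_eq:
  assumes "is_dist P"
  shows "mutual_info P W = (\<Sum>x\<in>UNIV. P x * kl (W x) (out_dist P W))"
  unfolding mutual_info_def kl_def sum_distrib_left
  by (intro sum.cong refl) (auto simp: mult.assoc)

text \<open>Mutual information is an average of divergences from channel laws to a mixture of them.
  The bound makes the supremum in \<open>capacity\<close> well behaved and, once capacity is
  attained, gives \<open>capacity W\<close> at most \<open>B\<close>.\<close>

lemma mutual_info_le_B:
  assumes "is_dist P"
  shows "mutual_info P W \<le> B"
proof -
  have "mutual_info P W \<le> (\<Sum>x\<in>UNIV. P x * B)"
    unfolding mutual_info_eq[OF assms] out_dist_mixture[OF assms]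
    using assms by (intro sum_mono mult_left_mono kl_mixture_le) (auto simp: is_dist_def)
  also have "\<dots> = B"
    using assms by (simp add: is_dist_def sum_distrib_right[symmetric])
  finally show ?thesis .
qed

lemma mutual_info_le_capacity: "is_dist P \<Longrightarrow> mutual_info P W \<le> capacity W"
  unfolding capacity_def using mutual_info_le_B
  by (intro cSup_upper bdd_aboveI[of _ B]) auto

lemma rel_entropy_eq: "rel_entropy (W x) (W x') = ereal (kl (W x) (W x'))"
proof -
  have "\<not> (\<exists>y. W x y > 0 \<and> W x' y = 0)"
    using full by (metis less_irrefl)
  then show ?thesis
    unfolding rel_entropy_def kl_def by (auto intro!: sum.cong)
qed

lemma maxKL_eq: "maxKL W = ereal B"
proof -
  obtain x x' where "B = kl (W x) (W x')" using B_attained by metis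
  moreover have "{rel_entropy (W x) (W x') | x x'. True} = range (\<lambda>(x, x'). ereal (kl (W x) (W x')))"
    by (auto simp: rel_entropy_eq)
  ultimately show ?thesis
    unfolding maxKL_def using kl_le_B
    by (auto intro!: Max_eqI)
qed

text \<open>Pushing the normalised weights forward along \<gamma> gives an input law
  \<open>P\<close> whose output law is the mixture, so the left side is the total mass times a
  mutual information.\<close>

lemma mixture_information_le_capacity:
  assumes "finite S" "\<And>w. w \<in> S \<Longrightarrow> p w \<ge> 0" "sum p S > 0"
  shows "(\<Sum>w\<in>S. p w * kl (W (\<gamma> w)) (mixture W S p \<gamma>)) \<le> sum p S * capacity W"
proof -
  define P where "P = (\<lambda>x. (\<Sum>w\<in>{w\<in>S. \<gamma> w = x}. p w) / sum p S)"
  have push: "(\<Sum>x\<in>UNIV. P x * h x) = (\<Sum>w\<in>S. p w * h (\<gamma> w)) / sum p S" for h :: "'x \<Rightarrow> real"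
  proof -
    have "(\<Sum>x\<in>UNIV. P x * h x) = (\<Sum>x\<in>UNIV. \<Sum>w\<in>{w\<in>S. \<gamma> w = x}. p w * h (\<gamma> w)) / sum p S"
      unfolding P_def sum_divide_distrib sum_distrib_right by (intro sum.cong refl) auto
    also have "\<dots> = (\<Sum>w\<in>S. p w * h (\<gamma> w)) / sum p S"
      using assms(1) by (subst sum.group) auto
    finally show ?thesis .
  qed
  have dist: "is_dist P"
    unfolding is_dist_def
  proof
    show "\<forall>x. P x \<ge> 0"
      unfolding P_def using assms by (auto intro!: divide_nonneg_pos sum_nonneg)
    show "sum P UNIV = 1"
      using push[of "\<lambda>_. 1"] assms(3) by simp
  qed
  have out: "out_dist P W = mixture W S p \<gamma>"
    by (rule ext) (simp add: out_dist_def push mixture_def)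
  have "(\<Sum>w\<in>S. p w * kl (W (\<gamma> w)) (mixture W S p \<gamma>)) / sum p S \<le> capacity W"
    using mutual_info_le_capacity[OF dist] unfolding mutual_info_eq[OF dist] out push .
  then show ?thesis using assms(3) by (simp add: field_simps)
qed

end

lemma regular_channelI:
  assumes "channel W" "maxKL W < \<infinity>"
  shows "regular_channel W"
proof
  show "channel W" by fact
  fix x x' y assume pos: "W x y > 0"
  have "rel_entropy (W x) (W x') \<le> maxKL W"
    unfolding maxKL_def
  proof (rule Max_ge)
    have "{rel_entropy (W x) (W x') | x x'. True} = range (\<lambda>(x, x'). rel_entropy (W x) (W x'))"
      by auto
    then show "finite {rel_entropy (W x) (W x') | x x'. True}" by simp
  qed auto
  then have "rel_entropy (W x) (W x') < \<infinity>"
    using assms(2) by (rule le_less_trans)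
  then have "\<not> (W x y > 0 \<and> W x' y = 0)"
    unfolding rel_entropy_def by (auto split: if_splits)
  moreover have "W x' y \<ge> 0"
    using assms(1) by (simp add: channel_def is_dist_def)
  ultimately show "W x' y > 0" using pos by linarith
qed

section \<open>One channel use\<close>

text \<open>The update stays unnormalised: its total is the joint weight of the past and
  \<open>y\<close>, so summing over \<open>y\<close> takes a conditional expectation without any
  division.\<close>

definition bayes :: "('x \<Rightarrow> 'y \<Rightarrow> real) \<Rightarrow> ('i \<Rightarrow> 'x) \<Rightarrow> ('i \<Rightarrow> real) \<Rightarrow> 'y \<Rightarrow> 'i \<Rightarrow> real" where
  "bayes W \<gamma> p y w = p w * W (\<gamma> w) y"

definition log_odds :: "'i set \<Rightarrow> ('i \<Rightarrow> real) \<Rightarrow> 'i \<Rightarrow> real" where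
  "log_odds S p w = ln (p w / sum p (S - {w}))"

text \<open>Total mass times the Shannon entropy of the normalised weights. Being homogeneous of
  degree one, it can be summed over output strings like a weight.\<close>

definition entropy :: "'i set \<Rightarrow> ('i \<Rightarrow> real) \<Rightarrow> real" where
  "entropy S p = (\<Sum>w\<in>S. p w * ln (sum p S / p w))"

text \<open>Derandomisation by conditional expectations. Independent inputs of law \<open>P\<close>
  give the right-hand side on average, since the pair terms have mean zero; the inputs are fixed one
  message at a time without falling below that average.\<close>

lemma greedy_assignment:
  fixes P :: "'x::finite \<Rightarrow> real" and S :: "'i set"
  assumes P: "is_dist P" and "finite S"
    and D: "(\<Sum>x\<in>UNIV. P x * D x) = C"
    and k1: "\<And>x'. (\<Sum>x\<in>UNIV. P x * k x x') = 0"
    and k2: "\<And>x. (\<Sum>x'\<in>UNIV. P x' * k x x') = 0"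
  shows "\<exists>\<gamma> :: 'i \<Rightarrow> 'x. (\<Sum>w\<in>S. a w * D (\<gamma> w)) + (\<Sum>w\<in>S. \<Sum>j\<in>S - {w}. b w j * k (\<gamma> w) (\<gamma> j))
    \<ge> sum a S * (C :: real)"
  using \<open>finite S\<close>
proof (induction S)
  case (insert i S)
  then obtain \<gamma> where \<gamma>: "sum a S * C \<le>
      (\<Sum>w\<in>S. a w * D (\<gamma> w)) + (\<Sum>w\<in>S. \<Sum>j\<in>S - {w}. b w j * k (\<gamma> w) (\<gamma> j))"
    by blast
  \<comment> \<open>\<open>g x\<close> collects the terms that depend on giving \<open>i\<close> the
    input \<open>x\<close>. As \<open>k\<close> is centred in each argument, only the one-body term
    survives averaging over \<open>P\<close>.\<close>
  define g where "g x = a i * D x + (\<Sum>j\<in>S. b i j * k x (\<gamma> j)) + (\<Sum>w\<in>S. b w i * k (\<gamma> w) x)" for x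
  have "(\<Sum>x\<in>UNIV. P x * g x) = a i * (\<Sum>x\<in>UNIV. P x * D x)
      + (\<Sum>j\<in>S. b i j * (\<Sum>x\<in>UNIV. P x * k x (\<gamma> j)))
      + (\<Sum>w\<in>S. b w i * (\<Sum>x\<in>UNIV. P x * k (\<gamma> w) x))"
    unfolding g_def distrib_left sum.distrib sum_distrib_left
    by (intro arg_cong2[where f = "(+)"] refl; (subst sum.swap)?) (auto intro!: sum.cong simp: algebra_simps)
  then have avg: "(\<Sum>x\<in>UNIV. P x * g x) = a i * C"
    by (simp add: D k1 k2)
  have "\<exists>x. g x \<ge> a i * C"
  proof (rule ccontr)
    assume "\<nexists>x. a i * C \<le> g x"
    then have less: "g x < a i * C" for x by (simp add: not_le)
    obtain x0 where "P x0 \<noteq> 0"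
      using P unfolding is_dist_def by (metis sum.neutral zero_neq_one)
    then have "P x0 > 0"
      using P by (simp add: is_dist_def less_le)
    then have "P x0 * g x0 < P x0 * (a i * C)"
      using less by simp
    moreover have "P x * g x \<le> P x * (a i * C)" for x
      using P less[of x] by (intro mult_left_mono) (auto simp: is_dist_def)
    ultimately have "(\<Sum>x\<in>UNIV. P x * g x) < (\<Sum>x\<in>UNIV. P x * (a i * C))"
      by (intro sum_strict_mono_ex1) auto
    then show False
      using avg P by (simp add: is_dist_def sum_distrib_right[symmetric])
  qed
  then obtain x where x: "g x \<ge> a i * C" by blast
  define \<gamma>' where "\<gamma>' = \<gamma>(i := x)"
  have \<gamma>'_S: "\<gamma>' w = \<gamma> w" if "w \<in> S" for w
    using that insert.hyps by (auto simp: \<gamma>'_def)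
  have \<gamma>'_i: "\<gamma>' i = x" by (simp add: \<gamma>'_def)
  have "(\<Sum>w\<in>insert i S. \<Sum>j\<in>insert i S - {w}. b w j * k (\<gamma>' w) (\<gamma>' j))
    = (\<Sum>j\<in>S. b i j * k x (\<gamma> j)) + (\<Sum>w\<in>S. b w i * k (\<gamma> w) x + (\<Sum>j\<in>S - {w}. b w j * k (\<gamma> w) (\<gamma> j)))"
  proof -
    have "insert i S - {i} = S" using insert.hyps by auto
    moreover have "(\<Sum>j\<in>insert i S - {w}. b w j * k (\<gamma>' w) (\<gamma>' j))
      = b w i * k (\<gamma> w) x + (\<Sum>j\<in>S - {w}. b w j * k (\<gamma> w) (\<gamma> j))" if "w \<in> S" for w
    proof -
      have "insert i S - {w} = insert i (S - {w})" using insert.hyps that by auto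
      then show ?thesis using insert.hyps that by (simp add: \<gamma>'_S \<gamma>'_i)
    qed
    ultimately show ?thesis
      using insert.hyps by (simp add: \<gamma>'_S \<gamma>'_i)
  qed
  moreover have "(\<Sum>w\<in>insert i S. a w * D (\<gamma>' w)) = a i * D x + (\<Sum>w\<in>S. a w * D (\<gamma> w))"
    using insert.hyps by (simp add: \<gamma>'_S \<gamma>'_i)
  ultimately have "sum a (insert i S) * C \<le> (\<Sum>w\<in>insert i S. a w * D (\<gamma>' w))
      + (\<Sum>w\<in>insert i S. \<Sum>j\<in>insert i S - {w}. b w j * k (\<gamma>' w) (\<gamma>' j))"
    using x \<gamma> insert.hyps unfolding g_def by (simp add: sum.distrib algebra_simps)
  then show ?case by blast
qed simp

lemma (in regular_channel) sum_bayes: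
  "(\<Sum>y\<in>UNIV. sum (bayes W \<gamma> p y) S) = sum p S"
  by (subst sum.swap) (simp add: bayes_def sum_distrib_left[symmetric] W_sum)

text \<open>At least two messages, all of positive weight: no posterior probability is 0 or 1, so
  all log-odds are finite.\<close>

locale weights = regular_channel W for W :: "'x::finite \<Rightarrow> 'y::finite \<Rightarrow> real" +
  fixes S :: "'i set" and p :: "'i \<Rightarrow> real"
  assumes fin: "finite S" and card_S: "card S \<ge> 2" and pos: "w \<in> S \<Longrightarrow> p w > 0"
begin

lemma others_pos: "w \<in> S \<Longrightarrow> sum p (S - {w}) > 0"
proof (rule sum_pos)
  assume "w \<in> S"
  then have "card (S - {w}) \<ge> 1"
    using fin card_S by simp
  then show "S - {w} \<noteq> {}" by fastforce
qed (use fin pos in auto)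

lemma total_pos: "sum p S > 0"
  using fin pos card_S by (intro sum_pos) auto

lemma total_split: "w \<in> S \<Longrightarrow> sum p S = p w + sum p (S - {w})"
  using fin by (rule sum.remove)

lemma nonneg: "w \<in> S - {v} \<Longrightarrow> p w \<ge> 0"
  using pos by (auto simp: less_imp_le)

lemma nonneg': "w \<in> S \<Longrightarrow> p w \<ge> 0"
  using pos by (auto simp: less_imp_le)

lemma mix_others_pos:
  "w \<in> S \<Longrightarrow> W x y > 0 \<Longrightarrow> mixture W (S - {w}) p \<gamma> y > 0"
  using fin by (intro mixture_pos nonneg others_pos) auto

text \<open>Against \<open>w\<close>, the other messages act as one alternative whose output law is
  their mixture.\<close>

lemma log_odds_bayes:
  assumes "w \<in> S" "W (\<gamma> w) y > 0"
  shows "log_odds S (bayes W \<gamma> p y) w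
    = log_odds S p w + ln (W (\<gamma> w) y / mixture W (S - {w}) p \<gamma> y)"
proof -
  have m: "mixture W (S - {w}) p \<gamma> y > 0"
    using assms by (rule mix_others_pos)
  have "sum (bayes W \<gamma> p y) (S - {w}) = mixture W (S - {w}) p \<gamma> y * sum p (S - {w})"
    using others_pos[OF assms(1)] by (simp add: mixture_def bayes_def)
  then show ?thesis
    using m assms pos[OF assms(1)] others_pos[OF assms(1)]
    by (simp add: log_odds_def bayes_def ln_mult ln_div)
qed

text \<open>The hypothesis is a tangent-line bound with error \<open>c\<close> for jumps of size at
  most \<open>K\<close>. Averaging it over \<open>y\<close> under the law of message
  \<open>w\<close> turns the jump \<open>v\<close> into a divergence, and \<open>w\<close> is then
  averaged over the posterior.\<close>

lemma potential_step:
  assumes "\<And>u v. \<bar>v\<bar> \<le> K \<Longrightarrow> f u + f' u * v - c \<le> f (u + v)"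
  shows "(\<Sum>w\<in>S. p w * f (log_odds S p w))
      + (\<Sum>w\<in>S. p w * (f' (log_odds S p w) * kl (W (\<gamma> w)) (mixture W (S - {w}) p \<gamma>)))
      - c * sum p S
    \<le> (\<Sum>y\<in>UNIV. \<Sum>w\<in>S. bayes W \<gamma> p y w * f (log_odds S (bayes W \<gamma> p y) w))"
proof -
  have "p w * f (log_odds S p w)
      + p w * (f' (log_odds S p w) * kl (W (\<gamma> w)) (mixture W (S - {w}) p \<gamma>)) - c * p w
    \<le> (\<Sum>y\<in>UNIV. bayes W \<gamma> p y w * f (log_odds S (bayes W \<gamma> p y) w))" if w: "w \<in> S" for w
  proof -
    let ?u = "log_odds S p w" and ?v = "\<lambda>y. ln (W (\<gamma> w) y / mixture W (S - {w}) p \<gamma> y)"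
    have "(\<Sum>y\<in>UNIV. p w * W (\<gamma> w) y * (f ?u + f' ?u * ?v y - c))
        \<le> (\<Sum>y\<in>UNIV. bayes W \<gamma> p y w * f (log_odds S (bayes W \<gamma> p y) w))"
    proof (rule sum_mono)
      fix y
      show "p w * W (\<gamma> w) y * (f ?u + f' ?u * ?v y - c)
          \<le> bayes W \<gamma> p y w * f (log_odds S (bayes W \<gamma> p y) w)"
      proof (cases "W (\<gamma> w) y = 0")
        case False
        then have W: "W (\<gamma> w) y > 0" using W_nonneg[of "\<gamma> w" y] by linarith
        have "\<bar>?v y\<bar> \<le> K"
          using fin W w by (intro abs_ln_mixture_le nonneg others_pos) auto
        then have "f ?u + f' ?u * ?v y - c \<le> f (?u + ?v y)" by (rule assms)
        then show ?thesis
          unfolding log_odds_bayes[of w \<gamma> y, OF w W] bayes_def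
          using W pos[OF w] by (intro mult_left_mono) auto
      qed (simp add: bayes_def)
    qed
    moreover have "(\<Sum>y\<in>UNIV. p w * W (\<gamma> w) y * (f ?u + f' ?u * ?v y - c))
      = p w * (f ?u - c) * (\<Sum>y\<in>UNIV. W (\<gamma> w) y)
        + p w * (f' ?u * kl (W (\<gamma> w)) (mixture W (S - {w}) p \<gamma>))"
      unfolding kl_def sum_distrib_left sum.distrib[symmetric]
      by (intro sum.cong refl) (simp add: algebra_simps)
    ultimately show ?thesis by (simp add: W_sum algebra_simps)
  qed
  then have "(\<Sum>w\<in>S. p w * f (log_odds S p w)
      + p w * (f' (log_odds S p w) * kl (W (\<gamma> w)) (mixture W (S - {w}) p \<gamma>)) - c * p w)
    \<le> (\<Sum>w\<in>S. \<Sum>y\<in>UNIV. bayes W \<gamma> p y w * f (log_odds S (bayes W \<gamma> p y) w))"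
    by (rule sum_mono)
  then show ?thesis
    by (subst sum.swap) (simp add: sum.distrib sum_subtractf sum_distrib_left)
qed

lemma log_odds_step:
  "(\<Sum>y\<in>UNIV. \<Sum>w\<in>S. bayes W \<gamma> p y w * log_odds S (bayes W \<gamma> p y) w)
    \<le> (\<Sum>w\<in>S. p w * log_odds S p w) + B * sum p S"
proof -
  \<comment> \<open>The drift is linear in the potential, so the lower bound applied to the negated
    log-odds gives the upper bound.\<close>
  have "(\<Sum>w\<in>S. p w * - log_odds S p w)
      + (\<Sum>w\<in>S. p w * (- 1 * kl (W (\<gamma> w)) (mixture W (S - {w}) p \<gamma>))) - 0 * sum p S
    \<le> (\<Sum>y\<in>UNIV. \<Sum>w\<in>S. bayes W \<gamma> p y w * - log_odds S (bayes W \<gamma> p y) w)"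
    by (rule potential_step) simp
  moreover have "(\<Sum>w\<in>S. p w * kl (W (\<gamma> w)) (mixture W (S - {w}) p \<gamma>)) \<le> (\<Sum>w\<in>S. p w * B)"
    using fin by (intro sum_mono mult_left_mono kl_mixture_le nonneg others_pos nonneg') auto
  ultimately show ?thesis
    by (simp add: sum_negf sum_distrib_right mult.commute[of B])
qed

text \<open>For i.i.d. random signals with law \<open>P\<close> the mixture of the other signals has mean the output
  law, so replacing the logarithm of the mixture by its tangent line there leaves an expression with
  mean \<open>C\<close> that is a sum of one-body and two-body terms.\<close>

lemma informative_assignment:
  assumes P: "is_dist P" "mutual_info P W = C"
  shows "\<exists>\<gamma>. sum p S * C \<le> (\<Sum>w\<in>S. p w * kl (W (\<gamma> w)) (mixture W (S - {w}) p \<gamma>))"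
proof -
  define Q where "Q = out_dist P W"
  define k where "k x x' = 1 - (\<Sum>y\<in>UNIV. W x y * (W x' y / Q y))" for x x'
  define r where "r w = sum p (S - {w})" for w
  have Q: "Q = mixture W UNIV P id"
    unfolding Q_def by (rule out_dist_mixture[OF P(1)])
  have Pn: "P x \<ge> 0" and Ps: "sum P UNIV = 1" for x
    using P(1) by (auto simp: is_dist_def)
  have Qpos: "Q y > 0" if "W x y > 0" for x y
    unfolding Q using that by (intro mixture_pos) (auto simp: Pn Ps)
  \<comment> \<open>Where \<open>Q y = 0\<close>, every \<open>W x y\<close> vanishes as well, so
    the convention for division by zero is harmless.\<close>
  have WQ: "W x y * (Q y / Q y) = W x y" for x y
    using Qpos[of x y] W_nonneg[of x y] by (cases "W x y = 0") auto
  have Qy: "(\<Sum>x\<in>UNIV. P x * W x y) = Q y" for y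
    by (simp add: Q_def out_dist_def)
  have k2: "(\<Sum>x'\<in>UNIV. P x' * k x x') = 0" for x
  proof -
    have "(\<Sum>x'\<in>UNIV. P x' * (\<Sum>y\<in>UNIV. W x y * (W x' y / Q y)))
        = (\<Sum>y\<in>UNIV. W x y * ((\<Sum>x'\<in>UNIV. P x' * W x' y) / Q y))"
      unfolding sum_distrib_left sum_divide_distrib
      by (subst sum.swap) (simp add: algebra_simps)
    then show ?thesis
      unfolding k_def by (simp only: right_diff_distrib sum_subtractf Qy WQ W_sum) (simp add: Ps)
  qed
  have "k x x' = k x' x" for x x'
    unfolding k_def by (simp add: algebra_simps)
  then have k1: "(\<Sum>x\<in>UNIV. P x * k x x') = 0" for x'
    using k2[of x'] by simp
  have D: "(\<Sum>x\<in>UNIV. P x * kl (W x) Q) = C"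
    using P mutual_info_eq[OF P(1)] by (simp add: Q_def)
  obtain \<gamma> where \<gamma>: "sum p S * C \<le> (\<Sum>w\<in>S. p w * kl (W (\<gamma> w)) Q)
      + (\<Sum>w\<in>S. \<Sum>j\<in>S - {w}. p w * p j / r w * k (\<gamma> w) (\<gamma> j))"
    using greedy_assignment[OF P(1) fin D k1 k2, of p "\<lambda>w j. p w * p j / r w"] by blast
  have "p w * kl (W (\<gamma> w)) Q + (\<Sum>j\<in>S - {w}. p w * p j / r w * k (\<gamma> w) (\<gamma> j))
      \<le> p w * kl (W (\<gamma> w)) (mixture W (S - {w}) p \<gamma>)" if w: "w \<in> S" for w
  proof -
    let ?m = "mixture W (S - {w}) p \<gamma>"
    have r: "r w > 0" unfolding r_def using w by (rule others_pos)
    have m: "?m y = (\<Sum>j\<in>S - {w}. p j * W (\<gamma> j) y) / r w" for y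
      by (simp add: mixture_def r_def)
    have "(\<Sum>j\<in>S - {w}. p j / r w * k (\<gamma> w) (\<gamma> j)) = 1 - (\<Sum>y\<in>UNIV. W (\<gamma> w) y * (?m y / Q y))"
    proof -
      have "(\<Sum>j\<in>S - {w}. p j / r w * (\<Sum>y\<in>UNIV. W (\<gamma> w) y * (W (\<gamma> j) y / Q y)))
          = (\<Sum>y\<in>UNIV. W (\<gamma> w) y * (?m y / Q y))"
        unfolding sum_distrib_left m sum_divide_distrib
        by (subst sum.swap) (simp add: algebra_simps)
      moreover have "(\<Sum>j\<in>S - {w}. p j / r w) = 1"
        using r by (simp add: sum_divide_distrib[symmetric] r_def)
      ultimately show ?thesis
        unfolding k_def right_diff_distrib sum_subtractf by simp
    qed
    moreover have "kl (W (\<gamma> w)) Q + (\<Sum>y\<in>UNIV. W (\<gamma> w) y * (1 - ?m y / Q y)) \<le> kl (W (\<gamma> w)) ?m"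
      unfolding kl_def sum.distrib[symmetric]
    proof (rule sum_mono)
      fix y
      show "W (\<gamma> w) y * ln (W (\<gamma> w) y / Q y) + W (\<gamma> w) y * (1 - ?m y / Q y)
          \<le> W (\<gamma> w) y * ln (W (\<gamma> w) y / ?m y)"
      proof (cases "W (\<gamma> w) y = 0")
        case False
        then have W: "W (\<gamma> w) y > 0" using W_nonneg[of "\<gamma> w" y] by linarith
        have mp: "?m y > 0" using w W by (rule mix_others_pos)
        have "ln (?m y / Q y) \<le> ?m y / Q y - 1"
          using mp Qpos[OF W] by (intro ln_le_minus_one) simp
        then have "ln (W (\<gamma> w) y / Q y) + (1 - ?m y / Q y) \<le> ln (W (\<gamma> w) y / ?m y)"
          using mp Qpos[OF W] W by (simp add: ln_div)
        then show ?thesis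
          using W unfolding distrib_left[symmetric] by (intro mult_left_mono) auto
      qed simp
    qed
    ultimately have "kl (W (\<gamma> w)) Q + (\<Sum>j\<in>S - {w}. p j / r w * k (\<gamma> w) (\<gamma> j)) \<le> kl (W (\<gamma> w)) ?m"
      by (simp add: right_diff_distrib sum_subtractf W_sum)
    then have "p w * (kl (W (\<gamma> w)) Q + (\<Sum>j\<in>S - {w}. p j / r w * k (\<gamma> w) (\<gamma> j))) \<le> p w * kl (W (\<gamma> w)) ?m"
      using pos[OF w] by (intro mult_left_mono) auto
    then show ?thesis by (simp add: distrib_left sum_distrib_left mult.assoc)
  qed
  then have "(\<Sum>w\<in>S. p w * kl (W (\<gamma> w)) Q + (\<Sum>j\<in>S - {w}. p w * p j / r w * k (\<gamma> w) (\<gamma> j)))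
      \<le> (\<Sum>w\<in>S. p w * kl (W (\<gamma> w)) (mixture W (S - {w}) p \<gamma>))"
    by (rule sum_mono)
  then show ?thesis
    using \<gamma> by (intro exI[of _ \<gamma>]) (simp add: sum.distrib)
qed

text \<open>When all other messages share one input, their mixture collapses to a single channel
  law, so the largest divergence is reached exactly.\<close>

lemma confirming_assignment:
  assumes "v \<in> S"
  shows "\<exists>\<gamma>. kl (W (\<gamma> v)) (mixture W (S - {v}) p \<gamma>) = B"
proof -
  obtain x x' where x: "kl (W x) (W x') = B" using B_attained by blast
  define \<gamma> where "\<gamma> = (\<lambda>w. if w = v then x else x')"
  have "mixture W (S - {v}) p \<gamma> = W x'"
  proof
    fix y
    have "(\<Sum>j\<in>S - {v}. p j * W (\<gamma> j) y) = (\<Sum>j\<in>S - {v}. p j) * W x' y"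
      unfolding sum_distrib_right by (rule sum.cong) (auto simp: \<gamma>_def)
    then show "mixture W (S - {v}) p \<gamma> y = W x' y"
      using others_pos[OF assms] by (simp add: mixture_def)
  qed
  then have "kl (W (\<gamma> v)) (mixture W (S - {v}) p \<gamma>) = B"
    using x by (simp add: \<gamma>_def)
  then show ?thesis by blast
qed

text \<open>While all log-odds are below \<open>a\<close>, the slope \<open>1 / C\<close> meets an
  average drift of at least \<open>C\<close>. Otherwise a leading message, with slope at least
  \<open>1 / B\<close> and drift \<open>B\<close>, contributes at least its own posterior weight,
  and all other contributions are nonnegative.\<close>

lemma drift_assignment:
  assumes P: "is_dist P" "mutual_info P W = C" and C: "C > 0"
    and step: "\<And>u v. \<bar>v\<bar> \<le> K \<Longrightarrow> f u + f' u * v - c \<le> f (u + v)"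
    and low: "\<And>u. u < a \<Longrightarrow> f' u = 1 / C" and f'_ge: "\<And>u. f' u \<ge> 1 / B"
  shows "\<exists>\<gamma>. (\<Sum>w\<in>S. p w * f (log_odds S p w)) + (1 - exp (- a) - c) * sum p S
    \<le> (\<Sum>y\<in>UNIV. \<Sum>w\<in>S. bayes W \<gamma> p y w * f (log_odds S (bayes W \<gamma> p y) w))"
proof -
  have B: "B > 0" using mutual_info_le_B[OF P(1)] P(2) C by linarith
  let ?D = "\<lambda>\<gamma> w. kl (W (\<gamma> w)) (mixture W (S - {w}) p \<gamma>)"
  have "\<exists>\<gamma>. (1 - exp (- a)) * sum p S \<le> (\<Sum>w\<in>S. p w * (f' (log_odds S p w) * ?D \<gamma> w))"
  proof (cases "\<forall>w\<in>S. log_odds S p w < a")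
    case True
    obtain \<gamma> where \<gamma>: "sum p S * C \<le> (\<Sum>w\<in>S. p w * ?D \<gamma> w)"
      using informative_assignment[OF P] by blast
    have "(\<Sum>w\<in>S. p w * (f' (log_odds S p w) * ?D \<gamma> w)) = (\<Sum>w\<in>S. p w * ?D \<gamma> w) / C"
      unfolding sum_divide_distrib using True low by (intro sum.cong) auto
    then have "sum p S \<le> (\<Sum>w\<in>S. p w * (f' (log_odds S p w) * ?D \<gamma> w))"
      using \<gamma> C by (simp add: pos_le_divide_eq)
    moreover have "(1 - exp (- a)) * sum p S \<le> 1 * sum p S"
      using total_pos by (intro mult_right_mono) auto
    ultimately show ?thesis by (intro exI[of _ \<gamma>]) linarith
  next
    case False
    then obtain v where v: "v \<in> S" "log_odds S p v \<ge> a" by force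
    have r: "sum p (S - {v}) > 0" using v(1) by (rule others_pos)
    \<comment> \<open>Log-odds of at least \<open>a\<close> leave the rivals of \<open>v\<close> at
      most the fraction \<open>exp (- a)\<close> of the mass.\<close>
    have "exp a \<le> p v / sum p (S - {v})"
      using v pos[OF v(1)] r unfolding log_odds_def by (subst (asm) ln_ge_iff) auto
    then have "sum p (S - {v}) \<le> exp (- a) * p v"
      using r by (simp add: exp_minus field_simps)
    also have "\<dots> \<le> exp (- a) * sum p S"
      using total_split[OF v(1)] r by (intro mult_left_mono) auto
    finally have pv: "(1 - exp (- a)) * sum p S \<le> p v"
      using total_split[OF v(1)] by (simp add: algebra_simps)
    obtain \<gamma> where \<gamma>: "?D \<gamma> v = B" using confirming_assignment[OF v(1)] by blast
    have "p v = p v * (1 / B * B)" using B by simp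
    also have "\<dots> \<le> p v * (f' (log_odds S p v) * ?D \<gamma> v)"
      unfolding \<gamma> using B pos[OF v(1)] f'_ge by (intro mult_left_mono mult_right_mono) auto
    also have "\<dots> \<le> (\<Sum>w\<in>S. p w * (f' (log_odds S p w) * ?D \<gamma> w))"
    proof (rule member_le_sum[OF v(1) _ fin])
      fix w assume w: "w \<in> S - {v}"
      have "f' (log_odds S p w) \<ge> 0" using f'_ge[of "log_odds S p w"] B
        by (meson divide_nonneg_pos order_trans zero_le_one)
      moreover have "?D \<gamma> w \<ge> 0"
        using w fin by (intro kl_mixture_nonneg nonneg others_pos) auto
      ultimately show "0 \<le> p w * (f' (log_odds S p w) * ?D \<gamma> w)"
        using w nonneg[of w v] by simp
    qed
    finally show ?thesis using pv by (intro exI[of _ \<gamma>]) linarith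
  qed
  then obtain \<gamma> where \<gamma>: "(1 - exp (- a)) * sum p S \<le> (\<Sum>w\<in>S. p w * (f' (log_odds S p w) * ?D \<gamma> w))"
    by blast
  show ?thesis
    using potential_step[OF step, of \<gamma>] \<gamma> by (intro exI[of _ \<gamma>]) (simp add: algebra_simps)
qed

text \<open>The mean entropy drop is the mutual information between input and output under the
  current posterior, hence at most the capacity.\<close>

lemma entropy_step:
  "entropy S p - capacity W * sum p S \<le> (\<Sum>y\<in>UNIV. entropy S (bayes W \<gamma> p y))"
proof -
  let ?m = "mixture W S p \<gamma>"
  have "bayes W \<gamma> p y w * ln (sum (bayes W \<gamma> p y) S / bayes W \<gamma> p y w)
      = p w * W (\<gamma> w) y * ln (sum p S / p w) - p w * (W (\<gamma> w) y * ln (W (\<gamma> w) y / ?m y))"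
    if w: "w \<in> S" for w y
  proof (cases "W (\<gamma> w) y = 0")
    case False
    then have W: "W (\<gamma> w) y > 0" using W_nonneg[of "\<gamma> w" y] by linarith
    have m: "?m y > 0"
      using fin W by (intro mixture_pos nonneg' total_pos) auto
    have "sum (bayes W \<gamma> p y) S = ?m y * sum p S"
      using total_pos by (simp add: mixture_def bayes_def)
    then show ?thesis
      using m W pos[OF w] total_pos by (simp add: bayes_def ln_mult ln_div algebra_simps)
  qed (simp add: bayes_def)
  then have "(\<Sum>y\<in>UNIV. entropy S (bayes W \<gamma> p y))
      = (\<Sum>y\<in>UNIV. \<Sum>w\<in>S. p w * W (\<gamma> w) y * ln (sum p S / p w) - p w * (W (\<gamma> w) y * ln (W (\<gamma> w) y / ?m y)))"
    unfolding entropy_def by (intro sum.cong) auto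
  also have "\<dots> = (\<Sum>w\<in>S. p w * ln (sum p S / p w) * (\<Sum>y\<in>UNIV. W (\<gamma> w) y)) - (\<Sum>w\<in>S. p w * kl (W (\<gamma> w)) ?m)"
    unfolding kl_def sum_distrib_left sum_subtractf[symmetric]
    by (subst sum.swap) (simp add: algebra_simps)
  also have "\<dots> \<ge> entropy S p - capacity W * sum p S"
    using mixture_information_le_capacity[OF fin nonneg' total_pos, of \<gamma>]
    by (simp add: W_sum entropy_def algebra_simps)
  finally show ?thesis .
qed

text \<open>Fano's inequality in unnormalised form: Gibbs' inequality against a reference
  \<open>q\<close> that puts one half on \<open>v\<close> and spreads the other half evenly.
  Dividing by \<open>card S\<close> keeps the total of \<open>q\<close> at most 1.\<close>

lemma fano:
  assumes v: "v \<in> S"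
  shows "entropy S p \<le> sum p S * ln 2 + sum p (S - {v}) * ln (card S)"
proof -
  define q where "q w = (if w = v then 1 / 2 else 1 / (2 * real (card S)))" for w
  have n: "real (card S) > 0" using card_S by simp
  have qpos: "q w > 0" for w using n by (simp add: q_def)
  have "sum q S = 1 / 2 + (\<Sum>w\<in>S - {v}. 1 / (2 * real (card S)))"
    using sum.remove[OF fin v, of q] by (simp add: q_def)
  also have "(\<Sum>w\<in>S - {v}. 1 / (2 * real (card S))) \<le> (\<Sum>w\<in>S. 1 / (2 * real (card S)))"
    using fin by (intro sum_mono2) auto
  finally have q: "sum q S \<le> 1" using n by simp
  have "p w * ln (sum p S / p w) \<le> - (p w * ln (q w)) + (sum p S * q w - p w)" if w: "w \<in> S" for w
  proof -
    have "ln (sum p S * q w / p w) \<le> sum p S * q w / p w - 1"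
      using total_pos pos[OF w] qpos[of w] by (intro ln_le_minus_one) simp
    then have "p w * ln (sum p S * q w / p w) \<le> p w * (sum p S * q w / p w - 1)"
      using pos[OF w] by (intro mult_left_mono) auto
    moreover have "ln (sum p S * q w / p w) = ln (sum p S / p w) + ln (q w)"
      using total_pos pos[OF w] qpos[of w] by (simp add: ln_mult ln_div)
    moreover have "p w * (sum p S * q w / p w - 1) = sum p S * q w - p w"
      using pos[OF w] by (simp add: right_diff_distrib)
    ultimately show ?thesis by (simp add: distrib_left)
  qed
  then have "entropy S p \<le> (\<Sum>w\<in>S. - (p w * ln (q w)) + (sum p S * q w - p w))"
    unfolding entropy_def by (rule sum_mono)
  also have "\<dots> = (\<Sum>w\<in>S. - (p w * ln (q w))) + (sum p S * sum q S - sum p S)"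
    by (simp add: sum.distrib sum_subtractf sum_distrib_left sum_negf)
  also have "\<dots> \<le> (\<Sum>w\<in>S. - (p w * ln (q w)))"
    using q total_pos by (simp add: mult_le_cancel_left1)
  also have "\<dots> = p v * ln 2 + (\<Sum>w\<in>S - {v}. p w * ln (2 * real (card S)))"
    using sum.remove[OF fin v, of "\<lambda>w. - (p w * ln (q w))"] n
    by (auto simp: q_def ln_div intro!: sum.cong)
  also have "\<dots> = sum p S * ln 2 + sum p (S - {v}) * ln (card S)"
    unfolding sum_distrib_right[symmetric] using n total_split[OF v]
    by (simp add: ln_mult algebra_simps)
  finally show ?thesis by simp
qed

section \<open>Posterior mean of the log-odds\<close>

lemma log_odds_eq:
  "w \<in> S \<Longrightarrow> log_odds S p w = ln (sum p S / sum p (S - {w})) - ln (sum p S / p w)"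
  using pos[of w] others_pos[of w] total_pos by (simp add: log_odds_def ln_div)

lemma average_log_odds_eq:
  "(\<Sum>w\<in>S. p w * log_odds S p w)
    = (\<Sum>w\<in>S. p w * ln (sum p S / sum p (S - {w}))) - entropy S p"
  unfolding entropy_def sum_subtractf[symmetric]
  by (intro sum.cong refl) (simp add: log_odds_eq algebra_simps)

lemma others_le_total: "w \<in> S \<Longrightarrow> sum p (S - {w}) \<le> sum p S"
  using pos total_split by (metis add.commute less_eq_real_def less_add_same_cancel1)

lemma entropy_nonneg: "entropy S p \<ge> 0"
  unfolding entropy_def
proof (intro sum_nonneg mult_nonneg_nonneg)
  fix w assume w: "w \<in> S"
  show "p w \<ge> 0" using w by (rule nonneg')
  show "ln (sum p S / p w) \<ge> 0"
    using pos[OF w] total_split[OF w] others_pos[OF w] by (intro ln_ge_zero) simp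
qed

text \<open>Only the term of \<open>v\<close> is kept, the others being nonnegative. Replacing its
  weight \<open>p v\<close> by the total costs at most one unit of mass, because
  \<open>x ln x\<close> is at least \<open>x - 1\<close>.\<close>

lemma average_log_odds_ge:
  assumes v: "v \<in> S"
  shows "sum p S * (- ln (sum p (S - {v}) / sum p S) - 1) - entropy S p
    \<le> (\<Sum>w\<in>S. p w * log_odds S p w)"
proof -
  let ?T = "sum p S" and ?r = "sum p (S - {v})"
  have r: "?r > 0" using v by (rule others_pos)
  have T: "?T > 0" by (rule total_pos)
  have l: "ln (?T / sum p (S - {w})) \<ge> 0" if w: "w \<in> S" for w
    using others_pos[OF w] others_le_total[OF w] by (intro ln_ge_zero) simp
  have "1 - 1 / (?r / ?T) \<le> ln (?r / ?T)"
    using r T by (intro ln_ge_one_minus) simp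
  then have "?r * (1 - 1 / (?r / ?T)) \<le> ?r * ln (?r / ?T)"
    using r by (intro mult_left_mono) auto
  moreover have "?r * (1 - 1 / (?r / ?T)) = ?r - ?T"
    using r by (simp add: right_diff_distrib)
  ultimately have "?r - ?T \<le> (?T - p v) * ln (?r / ?T)"
    using total_split[OF v] by simp
  then have "?T * (- ln (?r / ?T) - 1) \<le> p v * - ln (?r / ?T)"
    using r by (simp add: left_diff_distrib right_diff_distrib)
  also have "\<dots> = p v * ln (?T / ?r)"
    using r T by (simp add: ln_div)
  also have "\<dots> \<le> (\<Sum>w\<in>S. p w * ln (?T / sum p (S - {w})))"
    using l nonneg' v by (intro member_le_sum[of v S "\<lambda>w. p w * ln (?T / sum p (S - {w}))"] fin) auto
  finally show ?thesis unfolding average_log_odds_eq by simp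
qed

lemma bayes_weights: "W x y > 0 \<Longrightarrow> weights W S (bayes W \<gamma> p y)"
  using fin card_S pos full by unfold_locales (auto simp: bayes_def)

text \<open>The point is that one channel use changes every posterior by a bounded factor.\<close>

lemma average_log_odds_jump:
  assumes W: "W x y > 0" and \<delta>: "\<delta> > 0" "\<And>w. w \<in> S \<Longrightarrow> \<delta> * sum p S \<le> sum p (S - {w})"
  shows "(\<Sum>w\<in>S. bayes W \<gamma> p y w * log_odds S (bayes W \<gamma> p y) w)
    \<le> sum (bayes W \<gamma> p y) S * (2 * K + ln (1 / \<delta>))"
proof -
  interpret b: weights W S "bayes W \<gamma> p y" using W by (rule bayes_weights)
  let ?T = "sum (bayes W \<gamma> p y) S" and ?r = "\<lambda>w. sum (bayes W \<gamma> p y) (S - {w})"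
  have "ln (?T / ?r w) \<le> 2 * K + ln (1 / \<delta>)" if w: "w \<in> S" for w
  proof -
    \<comment> \<open>The two mixtures are compared through the common law \<open>W x\<close>, at
      one factor \<open>exp K\<close> each.\<close>
    have "mixture W S p \<gamma> y \<le> exp K * W x y"
      using fin by (intro mixture_bounds nonneg' total_pos) auto
    also have "\<dots> \<le> exp K * (exp K * mixture W (S - {w}) p \<gamma> y)"
      using fin w by (intro mult_left_mono mixture_bounds nonneg others_pos) auto
    finally have "mixture W S p \<gamma> y \<le> exp (2 * K) * mixture W (S - {w}) p \<gamma> y"
      by (simp add: exp_add[symmetric] mult.assoc[symmetric])
    moreover have T: "?T = mixture W S p \<gamma> y * sum p S"
      using total_pos by (simp add: mixture_def bayes_def)
    moreover have r: "?r w = mixture W (S - {w}) p \<gamma> y * sum p (S - {w})"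
      using others_pos[OF w] by (simp add: mixture_def bayes_def)
    moreover have "sum p S \<le> 1 / \<delta> * sum p (S - {w})"
      using \<delta>(1) \<delta>(2)[OF w] by (simp add: field_simps)
    ultimately have "?T \<le> (exp (2 * K) * mixture W (S - {w}) p \<gamma> y) * (1 / \<delta> * sum p (S - {w}))"
      using total_pos mix_others_pos[OF w W, of \<gamma>] unfolding T by (intro mult_mono) auto
    also have "\<dots> = exp (2 * K) * (1 / \<delta>) * ?r w" by (simp add: r)
    finally have "?T / ?r w \<le> exp (2 * K) * (1 / \<delta>)"
      using b.others_pos[OF w] by (simp add: pos_divide_le_eq)
    then have "ln (?T / ?r w) \<le> ln (exp (2 * K) * (1 / \<delta>))"
      using b.others_pos[OF w] b.total_pos by (intro ln_mono) auto
    then show ?thesis using \<delta>(1) by (simp add: ln_mult ln_div)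
  qed
  then have "(\<Sum>w\<in>S. bayes W \<gamma> p y w * ln (?T / ?r w))
      \<le> (\<Sum>w\<in>S. bayes W \<gamma> p y w * (2 * K + ln (1 / \<delta>)))"
    by (intro sum_mono mult_left_mono b.nonneg') auto
  then show ?thesis
    unfolding b.average_log_odds_eq sum_distrib_right using b.entropy_nonneg by linarith
qed

end

section \<open>Achievability for fixed length\<close>

text \<open>A concave, continuously differentiable function: slope 1 up to 0, then exponentially
  decaying slope with total further rise 1.\<close>

definition soft_kink :: "real \<Rightarrow> real" where
  "soft_kink u = (if u \<le> 0 then u else 1 - exp (- u))"

definition soft_kink' :: "real \<Rightarrow> real" where
  "soft_kink' u = (if u \<le> 0 then 1 else exp (- u))"

lemma exp_minus_le: "v \<ge> 0 \<Longrightarrow> exp (- v) \<le> 1 - v + v\<^sup>2" for v :: real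
proof -
  assume v: "v \<ge> 0"
  \<comment> \<open>The product equals 1 plus the cube of \<open>v\<close>.\<close>
  have "1 \<le> (1 - v + v\<^sup>2) * (1 + v)"
    using v by (simp add: algebra_simps power2_eq_square)
  also have "\<dots> \<le> (1 - v + v\<^sup>2) * exp v"
  proof (rule mult_left_mono)
    have "0 \<le> (v - 1)\<^sup>2 + v" using v by simp
    then show "0 \<le> 1 - v + v\<^sup>2" using v by (simp add: power2_eq_square algebra_simps)
  qed (rule exp_ge_add_one_self)
  finally show ?thesis by (simp add: exp_minus field_simps)
qed

text \<open>The slope \<open>soft_kink'\<close> is 1-Lipschitz, so the tangent line overshoots by at
  most a quadratic term. The cases follow the sides of the kink on which the two points lie.\<close>

lemma soft_kink_step: "soft_kink u + soft_kink' u * v - v\<^sup>2 \<le> soft_kink (u + v)"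
proof -
  consider "u \<le> 0" "u + v \<le> 0" | "u \<le> 0" "u + v > 0" | "u > 0" "u + v \<le> 0" | "u > 0" "u + v > 0"
    by linarith
  then show ?thesis
  proof cases
    case 1
    then show ?thesis by (simp add: soft_kink_def soft_kink'_def)
  next
    case 2
    have "(u + v)\<^sup>2 \<le> v\<^sup>2" using 2 by (intro power_mono) auto
    moreover have "exp (- (u + v)) \<le> 1 - (u + v) + (u + v)\<^sup>2" using 2 by (intro exp_minus_le) auto
    ultimately have "u + v - v\<^sup>2 \<le> 1 - exp (- (u + v))" by linarith
    then show ?thesis
      using 2 by (simp add: soft_kink_def soft_kink'_def)
  next
    case 3
    let ?t = "- (u + v)"
    have e: "1 - u \<le> exp (- u)" "exp (- u) \<le> 1" using exp_ge_add_one_self[of "- u"] 3 by simp_all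
    have "?t * (1 - exp (- u)) \<le> ?t * u" using 3 e by (intro mult_left_mono) auto
    moreover have "(1 - u) * (1 + u) \<le> exp (- u) * (1 + u)"
      using 3 e by (intro mult_right_mono) auto
    moreover have "?t * u + u\<^sup>2 \<le> v\<^sup>2"
    proof -
      have "v = - ?t - u" by simp
      then have "v\<^sup>2 = ?t\<^sup>2 + 2 * (?t * u) + u\<^sup>2"
        by (simp add: power2_eq_square algebra_simps)
      moreover have "?t * u \<ge> 0" using 3 by (intro mult_nonneg_nonneg) auto
      ultimately show ?thesis using zero_le_power2[of ?t] by linarith
    qed
    ultimately show ?thesis
      using 3 by (simp add: soft_kink_def soft_kink'_def algebra_simps power2_eq_square)
  next
    case 4
    have "exp (- v) \<le> 1 - v + v\<^sup>2 * exp u"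
    proof (cases "v \<ge> 0")
      case True
      have "v\<^sup>2 * 1 \<le> v\<^sup>2 * exp u" using 4 by (intro mult_left_mono) auto
      then show ?thesis using exp_minus_le[OF True] by simp
    next
      case False
      have "(1 + v) * exp (- v) \<le> 1"
        using exp_ge_add_one_self[of v] by (simp add: exp_minus field_simps)
      then have "(1 + v) * exp (- v) * (1 - v) \<le> 1 * (1 - v)"
        using False by (intro mult_right_mono) auto
      then have "exp (- v) \<le> 1 - v + v\<^sup>2 * exp (- v)"
        by (simp add: power2_eq_square algebra_simps)
      moreover have "v\<^sup>2 * exp (- v) \<le> v\<^sup>2 * exp u"
        using 4 by (intro mult_left_mono) auto
      ultimately show ?thesis by linarith
    qed
    then have "exp (- u) * exp (- v) \<le> exp (- u) * (1 - v + v\<^sup>2 * exp u)"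
      by (intro mult_left_mono) auto
    also have "\<dots> = exp (- u) * (1 - v) + v\<^sup>2"
      by (simp add: distrib_left exp_minus)
    finally have "exp (- (u + v)) \<le> exp (- u) * (1 - v) + v\<^sup>2"
      by (simp add: exp_add[symmetric])
    then show ?thesis
      using 4 by (simp add: soft_kink_def soft_kink'_def right_diff_distrib)
  qed
qed

text \<open>Stretching the soft kink by \<open>R\<close> divides its curvature by \<open>R\<close>.
  Added to the line of slope \<open>1 / B\<close> with factor \<open>s\<close>, the difference of
  the two slopes, it yields slope \<open>1 / C\<close> up to \<open>a\<close> and slope tending to
  \<open>1 / B\<close> beyond.\<close>

lemma kinked_potential:
  fixes C B a R :: real
  assumes "0 < C" "C \<le> B" "R > 0"
  obtains f f' where "\<And>u. u \<le> a \<Longrightarrow> f u = u / C" "\<And>u. u \<le> a \<Longrightarrow> f' u = 1 / C"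
    "\<And>u. f' u \<ge> 1 / B" "\<And>u. f u \<le> u / B + (a + R) / C - a / B"
    "\<And>u v. f u + f' u * v - v\<^sup>2 / (C * R) \<le> f (u + v)"
proof
  define s where "s = 1 / C - 1 / B"
  define f where "f u = u / B + s * (a + R * soft_kink ((u - a) / R))" for u
  define f' where "f' u = 1 / B + s * soft_kink' ((u - a) / R)" for u
  have s: "0 \<le> s" "s \<le> 1 / C" unfolding s_def using assms by (auto simp: field_simps)
  show "f u = u / C" if "u \<le> a" for u
    using that assms by (simp add: f_def soft_kink_def s_def divide_le_0_iff field_simps)
  show "f' u = 1 / C" if "u \<le> a" for u
    using that assms by (simp add: f'_def soft_kink'_def s_def divide_le_0_iff)
  show "f' u \<ge> 1 / B" for u
    using s by (simp add: f'_def soft_kink'_def)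
  show "f u \<le> u / B + (a + R) / C - a / B" for u
  proof -
    have "soft_kink v \<le> 1" for v
      by (simp add: soft_kink_def)
    then have "s * (R * soft_kink ((u - a) / R)) \<le> s * (R * 1)"
      using s assms by (intro mult_left_mono) auto
    also have "\<dots> \<le> 1 / C * R" using s assms by (simp add: mult_right_mono del: times_divide_eq_left)
    finally show ?thesis
      unfolding f_def by (simp add: distrib_left s_def left_diff_distrib add_divide_distrib)
  qed
  show "f u + f' u * v - v\<^sup>2 / (C * R) \<le> f (u + v)" for u v
  proof -
    let ?u = "(u - a) / R" and ?v = "v / R"
    have "s * (R * (soft_kink ?u + soft_kink' ?u * ?v - ?v\<^sup>2)) \<le> s * (R * soft_kink (?u + ?v))"
      using s assms soft_kink_step[of ?u ?v] by (intro mult_left_mono) simp_all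
    moreover have "s * (R * ?v\<^sup>2) \<le> 1 / C * (R * ?v\<^sup>2)"
      using s assms by (intro mult_right_mono) auto
    moreover have "1 / C * (R * ?v\<^sup>2) = v\<^sup>2 / (C * R)"
      using assms by (simp add: power2_eq_square)
    moreover have "?u + ?v = (u + v - a) / R" by (simp add: add_divide_distrib diff_divide_distrib)
    moreover have "s * (R * (soft_kink ?u + soft_kink' ?u * ?v - ?v\<^sup>2))
        = s * (R * soft_kink ?u) + s * soft_kink' ?u * v - s * (R * ?v\<^sup>2)"
      using assms by (simp add: algebra_simps)
    ultimately show ?thesis
      unfolding f_def f'_def by (simp add: distrib_left distrib_right add_divide_distrib)
  qed
qed

section \<open>Feedback encoders driven by the posterior\<close>

lemma out_prob_bayes:
  "(\<lambda>w. out_prob W enc w (ys @ [y])) = bayes W (\<lambda>w. enc w ys) (\<lambda>w. out_prob W enc w ys) y"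
  by (rule ext) (simp add: bayes_def out_prob_snoc)

text \<open>The inputs depend on likelihoods that depend on earlier inputs. The circularity is
  resolved by folding the weight vector along the outputs, starting from equal weights.\<close>

lemma adaptive_encoder:
  "\<exists>enc. \<forall>ys. (\<lambda>w. enc w ys) = G (\<lambda>w. out_prob W enc w ys)"
proof -
  define st where "st = foldl (\<lambda>p y. bayes W (G p) p y) (\<lambda>_. 1)"
  define enc where "enc w ys = G (st ys) w" for w ys
  have "out_prob W enc w ys = st ys w" for w ys
    by (induction ys rule: rev_induct)
       (simp_all add: st_def out_prob_Nil out_prob_snoc bayes_def enc_def)
  then show ?thesis by (intro exI[of _ enc]) (simp add: enc_def)
qed

context regular_channel
begin

lemma out_prob_nonneg: "out_prob W enc w ys \<ge> 0"
  unfolding out_prob_def by (intro prod_nonneg) (simp add: W_nonneg)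

text \<open>Since all channel laws share their support, an output string is possible under every
  message or under none.\<close>

lemma out_prob_cases:
  assumes "M \<ge> 2"
  obtains "weights W {1..M} (\<lambda>w. out_prob W enc w ys)" | "\<And>w. out_prob W enc w ys = 0"
proof -
  have "weights W {1..M} (\<lambda>w. out_prob W enc w ys) \<or> (\<forall>w. out_prob W enc w ys = 0)"
  proof (induction ys rule: rev_induct)
    case Nil
    show ?case using assms by (intro disjI1, unfold_locales) (auto simp: out_prob_Nil)
  next
    case (snoc y ys)
    show ?case
    proof (cases "(\<forall>x. W x y = 0) \<or> (\<forall>w. out_prob W enc w ys = 0)")
      case True
      then show ?thesis by (auto simp: out_prob_snoc)
    next
      case False
      then obtain x where "W x y > 0" using W_nonneg by (metis less_le)
      moreover have "weights W {1..M} (\<lambda>w. out_prob W enc w ys)" using snoc False by blast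
      ultimately show ?thesis
        unfolding out_prob_bayes by (blast intro: weights.bayes_weights)
    qed
  qed
  then show ?thesis using that by blast
qed

text \<open>The total likelihood is a martingale; it starts at \<open>M\<close> because each message
  has prior weight 1.\<close>

lemma stopping_mass:
  fixes enc :: "nat \<Rightarrow> 'y list \<Rightarrow> 'x" and M :: nat
  defines "T \<equiv> \<lambda>ys. \<Sum>w\<in>{1..M}. out_prob W enc w ys"
  shows "surv_sum stop n T + (\<Sum>k\<le>n. stop_sum stop k T) = real M"
proof -
  have "(\<Sum>y\<in>UNIV. T (ys @ [y])) = T ys" for ys
    using sum_bayes[of "\<lambda>w. enc w ys" "\<lambda>w. out_prob W enc w ys" "{1..M}"]
    by (simp add: T_def out_prob_bayes[symmetric, THEN fun_cong])
  then have "surv_sum stop n T + (\<Sum>k\<le>n. stop_sum stop k T) = T []"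
    by (rule optional_stopping_eq)
  then show ?thesis by (simp add: T_def out_prob_Nil)
qed

text \<open>The potential \<open>F\<close> gains a fixed amount per unit of surviving mass, starts
  near \<open>- M * ln M / C\<close>, and stays below \<open>Z\<close> times the mass. The
  difference bounds the expected time; the threshold \<open>b\<close> alone bounds the
  error.\<close>

lemma posterior_threshold_code:
  assumes P: "is_dist P" "mutual_info P W = C" and C: "C > 0" and M: "M \<ge> 2"
    and a: "a \<ge> 0" and R: "R > 0" and b: "b \<ge> 0"
  shows "\<exists>enc stop dec. (\<forall>ys. dec ys \<in> {1..M})
    \<and> (\<forall>n. (1 - exp (- a) - K\<^sup>2 / (C * R)) * (\<Sum>k<n. prob_tau_gt W M enc stop k)
          \<le> ln (real M) / C + (b + K) / B + (a + R) / C)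
    \<and> (\<forall>n. (\<Sum>k\<le>n. stop_sum stop k (\<lambda>ys. \<Sum>w\<in>{1..M} - {dec ys}. out_prob W enc w ys) / real M)
          \<le> exp (- b))"
proof -
  have CB: "C \<le> B" using mutual_info_le_B[OF P(1)] P(2) by simp
  then have B: "B > 0" using C by linarith
  obtain f f' where f: "\<And>u. u \<le> a \<Longrightarrow> f u = u / C" "\<And>u. u \<le> a \<Longrightarrow> f' u = 1 / C"
    "\<And>u. f' u \<ge> 1 / B" "\<And>u. f u \<le> u / B + (a + R) / C - a / B"
    and step: "\<And>u v. f u + f' u * v - v\<^sup>2 / (C * R) \<le> f (u + v)"
    using kinked_potential[OF C CB R] by blast
  let ?c = "K\<^sup>2 / (C * R)"
  have step': "f u + f' u * v - ?c \<le> f (u + v)" if "\<bar>v\<bar> \<le> K" for u v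
  proof -
    have "v\<^sup>2 / (C * R) \<le> ?c"
      using that C R by (intro divide_right_mono abs_le_square_iff[THEN iffD1]) auto
    then show ?thesis using step[of u v] by linarith
  qed
  let ?S = "{1..M}"
  define good where "good p \<gamma> \<longleftrightarrow> (\<Sum>w\<in>?S. p w * f (log_odds ?S p w)) + (1 - exp (- a) - ?c) * sum p ?S
    \<le> (\<Sum>y\<in>UNIV. \<Sum>w\<in>?S. bayes W \<gamma> p y w * f (log_odds ?S (bayes W \<gamma> p y) w))" for p \<gamma>
  \<comment> \<open>Keeping the implication under the quantifier lets the choice function
    \<open>G\<close> be total.\<close>
  have "\<exists>\<gamma>. weights W ?S p \<longrightarrow> good p \<gamma>" for p
    using weights.drift_assignment[of W ?S p P C f f' ?c a, OF _ P C step' f(2) f(3)]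
    unfolding good_def by fastforce
  then obtain G where G: "\<And>p. weights W ?S p \<Longrightarrow> good p (G p)"
    by metis
  obtain enc where enc: "\<And>ys. (\<lambda>w. enc w ys) = G (\<lambda>w. out_prob W enc w ys)"
    using adaptive_encoder[of G W] by blast
  define p where "p ys w = out_prob W enc w ys" for ys w
  define T where "T ys = sum (p ys) ?S" for ys
  define L where "L ys w = log_odds ?S (p ys) w" for ys w
  define F where "F ys = (\<Sum>w\<in>?S. p ys w * f (L ys w))" for ys
  have p_Nil: "p [] w = 1" for w by (simp add: p_def out_prob_Nil)
  have p_snoc: "p (ys @ [y]) = bayes W (G (p ys)) (p ys) y" for ys y
    unfolding p_def using out_prob_bayes[of W enc ys y] by (simp add: enc fun_eq_iff)
  have cases: "weights W ?S (p ys) \<or> (\<forall>w. p ys w = 0)" for ys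
    using out_prob_cases[OF M, of enc ys] unfolding p_def by metis
  have T_nonneg: "T ys \<ge> 0" for ys
    using cases[of ys] weights.total_pos[of W ?S "p ys"] by (auto simp: T_def)
  have drift: "(1 - exp (- a) - ?c) * T ys \<le> (\<Sum>y\<in>UNIV. F (ys @ [y])) - F ys" for ys
    using cases[of ys]
  proof
    assume "weights W ?S (p ys)"
    then have "good (p ys) (G (p ys))" by (rule G)
    then show ?thesis unfolding good_def T_def F_def L_def p_snoc by simp
  next
    assume z: "\<forall>w. p ys w = 0"
    then show ?thesis unfolding T_def F_def p_snoc by (simp add: bayes_def)
  qed
  define stop where "stop ys \<longleftrightarrow> (\<exists>w\<in>?S. L ys w \<ge> b)" for ys
  define dec where "dec ys = (if stop ys then SOME w. w \<in> ?S \<and> L ys w \<ge> b else 1)" for ys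
  have dec_stop: "dec ys \<in> ?S \<and> L ys (dec ys) \<ge> b" if "stop ys" for ys
  proof -
    have "\<exists>w. w \<in> ?S \<and> L ys w \<ge> b" using that by (auto simp: stop_def)
    from someI_ex[OF this] show ?thesis using that by (simp add: dec_def)
  qed
  have dec: "dec ys \<in> ?S" for ys
    using dec_stop[of ys] M by (cases "stop ys") (auto simp: dec_def)
  \<comment> \<open>The largest potential per unit mass, allowing for a last step that overshoots
    \<open>b\<close> by at most \<open>K\<close>.\<close>
  define Z where "Z = (b + K) / B + (a + R) / C"
  have F_le: "F ys \<le> Z * T ys" if "weights W ?S (p ys) \<Longrightarrow> \<forall>w\<in>?S. L ys w \<le> b + K" for ys
    using cases[of ys]
  proof
    assume w: "weights W ?S (p ys)"
    interpret weights W ?S "p ys" by (rule w)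
    have "f (L ys w) \<le> Z" if "w \<in> ?S" for w
    proof -
      have "L ys w / B \<le> (b + K) / B"
        using \<open>weights W ?S (p ys) \<Longrightarrow> \<forall>w\<in>?S. L ys w \<le> b + K\<close>[OF w] that B
        by (intro divide_right_mono) auto
      moreover have "a / B \<ge> 0" using a B by simp
      ultimately show ?thesis using f(4)[of "L ys w"] by (simp add: Z_def)
    qed
    then show ?thesis
      unfolding F_def T_def sum_distrib_left using nonneg'
      by (intro sum_mono) (simp add: mult.commute[of Z] mult_left_mono)
  qed (simp add: F_def T_def)
  have surv: "F ys \<le> Z * T ys" if "survives stop ys" for ys
  proof (rule F_le, rule ballI)
    fix w assume w: "w \<in> ?S"
    have "\<not> stop ys" using that unfolding survives_def by (metis order_refl take_all)
    then show "L ys w \<le> b + K" using w K_nonneg by (force simp: stop_def)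
  qed
  have L_Nil: "L [] w = - ln (real M - 1)" if "w \<in> ?S" for w
    using that M by (simp add: L_def log_odds_def p_Nil ln_div of_nat_diff)
  have stops: "F ys \<le> Z * T ys" if st: "stops_at stop ys" for ys
  proof (rule F_le, rule ballI)
    fix w assume w: "w \<in> ?S" and wt: "weights W ?S (p ys)"
    show "L ys w \<le> b + K"
    proof (cases ys rule: rev_cases)
      \<comment> \<open>Stopping at time 0 has no preceding string below the threshold, so the prior
        log-odds are used directly.\<close>
      case Nil
      have "L ys w \<le> 0" using M L_Nil[OF w] by (simp add: Nil)
      then show ?thesis using b K_nonneg by linarith
    next
      case (snoc zs y)
      have W: "p zs w > 0" "W (G (p zs) w) y > 0"
        using weights.pos[OF wt w] W_nonneg[of "G (p zs) w" y] w
        unfolding snoc p_snoc bayes_def by (auto simp: zero_less_mult_iff)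
      then interpret z: weights W ?S "p zs" using cases[of zs] by force
      have "\<not> stop zs"
        using st unfolding snoc stops_at_snoc survives_def by (metis order_refl take_all)
      then have "L zs w < b" using w by (force simp: stop_def)
      moreover have "\<bar>ln (W (G (p zs) w) y / mixture W (?S - {w}) (p zs) (G (p zs)) y)\<bar> \<le> K"
        using w W by (intro abs_ln_mixture_le z.nonneg z.others_pos) auto
      ultimately show ?thesis
        unfolding L_def snoc p_snoc z.log_odds_bayes[where \<gamma> = "G (p zs)", OF w W(2)] by linarith
    qed
  qed
  have T_eq: "T = (\<lambda>ys. \<Sum>w\<in>?S. out_prob W enc w ys)" by (simp add: T_def p_def fun_eq_iff)
  have M0: "real M > 0" using M by simp
  have time: "(1 - exp (- a) - ?c) * (\<Sum>k<n. prob_tau_gt W M enc stop k)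
      \<le> ln (real M) / C + (b + K) / B + (a + R) / C" for n
  proof -
    have "F [] + (\<Sum>k<n. surv_sum stop k (\<lambda>ys. (1 - exp (- a) - ?c) * T ys))
        \<le> surv_sum stop n F + (\<Sum>k\<le>n. stop_sum stop k F)"
      using drift by (rule optional_stopping_ge)
    also have "\<dots> \<le> surv_sum stop n (\<lambda>ys. Z * T ys) + (\<Sum>k\<le>n. stop_sum stop k (\<lambda>ys. Z * T ys))"
      using surv stops by (intro add_mono sum_mono surv_sum_mono stop_sum_mono) auto
    also have "\<dots> = Z * (surv_sum stop n T + (\<Sum>k\<le>n. stop_sum stop k T))"
      by (simp add: surv_sum_cmult stop_sum_cmult sum_distrib_left distrib_left)
    also have "\<dots> = Z * real M" unfolding T_eq stopping_mass ..
    finally have 1: "F [] + (1 - exp (- a) - ?c) * (\<Sum>k<n. surv_sum stop k T) \<le> Z * real M"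
      by (simp add: surv_sum_cmult sum_distrib_left)
    have "- ln (real M - 1) \<le> 0" using M by simp
    \<comment> \<open>The prior log-odds are at most 0, hence in the range where \<open>f\<close> is
      linear with slope \<open>1 / C\<close>; this is the source of the term
      \<open>ln M / C\<close>.\<close>
    then have "f (- ln (real M - 1)) = - ln (real M - 1) / C" using a by (intro f(1)) linarith
    then have "F [] = real M * (- ln (real M - 1) / C)"
      by (simp add: F_def p_Nil L_Nil)
    also have "\<dots> \<ge> real M * (- ln (real M) / C)"
      using M C by (intro mult_left_mono divide_right_mono) auto
    finally have "(1 - exp (- a) - ?c) * (\<Sum>k<n. surv_sum stop k T) \<le> (Z + ln (real M) / C) * real M"
      using 1 by (simp add: algebra_simps)
    moreover have "(\<Sum>k<n. prob_tau_gt W M enc stop k) = (\<Sum>k<n. surv_sum stop k T) / real M"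
      unfolding prob_tau_gt_eq T_eq by (simp add: sum_divide_distrib)
    ultimately have "(1 - exp (- a) - ?c) * (\<Sum>k<n. prob_tau_gt W M enc stop k) \<le> Z + ln (real M) / C"
      using M0 by (simp add: pos_divide_le_eq)
    then show ?thesis by (simp add: Z_def)
  qed
  have err: "(\<Sum>k\<le>n. stop_sum stop k (\<lambda>ys. \<Sum>w\<in>?S - {dec ys}. out_prob W enc w ys) / real M) \<le> exp (- b)"
    for n
  proof -
    have "(\<Sum>w\<in>?S - {dec ys}. out_prob W enc w ys) \<le> exp (- b) * T ys" if "stops_at stop ys" for ys
      using cases[of ys]
    proof
      assume "weights W ?S (p ys)"
      then interpret weights W ?S "p ys" .
      have d: "dec ys \<in> ?S" "L ys (dec ys) \<ge> b"
        using dec_stop[of ys] that by (auto simp: stops_at_def)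
      have r: "sum (p ys) (?S - {dec ys}) > 0" using d(1) by (rule others_pos)
      have "exp b \<le> p ys (dec ys) / sum (p ys) (?S - {dec ys})"
        using d pos[OF d(1)] r unfolding L_def log_odds_def by (subst (asm) ln_ge_iff) auto
      then have "sum (p ys) (?S - {dec ys}) \<le> exp (- b) * p ys (dec ys)"
        using r by (simp add: exp_minus field_simps)
      also have "\<dots> \<le> exp (- b) * T ys"
        using total_split[OF d(1)] r by (simp add: T_def)
      finally show ?thesis by (simp add: p_def)
    next
      assume z: "\<forall>w. p ys w = 0"
      then show ?thesis using T_nonneg[of ys] by (simp add: p_def)
    qed
    then have "(\<Sum>k\<le>n. stop_sum stop k (\<lambda>ys. \<Sum>w\<in>?S - {dec ys}. out_prob W enc w ys))
        \<le> (\<Sum>k\<le>n. stop_sum stop k (\<lambda>ys. exp (- b) * T ys))"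
      by (intro sum_mono stop_sum_mono) auto
    also have "\<dots> = exp (- b) * (\<Sum>k\<le>n. stop_sum stop k T)"
      by (simp add: stop_sum_cmult sum_distrib_left)
    also have "\<dots> \<le> exp (- b) * real M"
      using stopping_mass[where stop = stop and n = n and M = M and enc = enc] surv_sum_nonneg[of T stop n] T_nonneg
      unfolding T_eq by (intro mult_left_mono) auto
    finally show ?thesis
      using M0 by (simp add: sum_divide_distrib[symmetric] pos_divide_le_eq)
  qed
  show ?thesis using dec time err by blast
qed

text \<open>The bounds at every truncation pass to the limit for series of nonnegative terms;
  \<open>small\<close> makes the drift positive, so it can be cancelled.\<close>

lemma VLF_code_exists:
  assumes P: "is_dist P" "mutual_info P W = C" and C: "C > 0" and M: "M \<ge> 2"
    and a: "a \<ge> 0" and R: "R > 0" and b: "b \<ge> 0" and N: "N > 0"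
    and small: "exp (- a) + K\<^sup>2 / (C * R) < 1"
    and len: "ln (real M) / C + (b + K) / B + (a + R) / C \<le> (1 - exp (- a) - K\<^sup>2 / (C * R)) * N"
  shows "\<exists>enc stop dec. is_VLF_code W M N enc stop dec \<and> 0 \<le> err_prob W M enc stop dec
    \<and> err_prob W M enc stop dec \<le> exp (- b)"
proof -
  obtain enc stop dec where dec: "\<And>ys. dec ys \<in> {1..M}"
    and time: "\<And>n. (1 - exp (- a) - K\<^sup>2 / (C * R)) * (\<Sum>k<n. prob_tau_gt W M enc stop k)
      \<le> ln (real M) / C + (b + K) / B + (a + R) / C"
    and err: "\<And>n. (\<Sum>k\<le>n. stop_sum stop k (\<lambda>ys. \<Sum>w\<in>{1..M} - {dec ys}. out_prob W enc w ys) / real M)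
      \<le> exp (- b)"
    using posterior_threshold_code[OF P C M a R b] by blast
  have pt: "prob_tau_gt W M enc stop k \<ge> 0" for k
    unfolding prob_tau_gt_eq by (intro divide_nonneg_nonneg surv_sum_nonneg sum_nonneg out_prob_nonneg) simp
  have "(\<Sum>k<n. ennreal (prob_tau_gt W M enc stop k)) \<le> ennreal N" for n
  proof -
    have "(1 - exp (- a) - K\<^sup>2 / (C * R)) * (\<Sum>k<n. prob_tau_gt W M enc stop k)
        \<le> (1 - exp (- a) - K\<^sup>2 / (C * R)) * N"
      using time len by (rule order_trans)
    then have "(\<Sum>k<n. prob_tau_gt W M enc stop k) \<le> N"
      by (rule mult_left_le_imp_le) (use small in linarith)
    then show ?thesis using pt by (simp add: sum_ennreal ennreal_leI)
  qed
  then have "exp_tau W M enc stop \<le> ennreal N"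
    unfolding exp_tau_def suminf_eq_SUP by (rule SUP_least)
  then have code: "is_VLF_code W M N enc stop dec"
    using M N dec by (simp add: is_VLF_code_def)
  let ?e = "\<lambda>k. stop_sum stop k (\<lambda>ys. \<Sum>w\<in>{1..M} - {dec ys}. out_prob W enc w ys) / real M"
  have nn: "?e k \<ge> 0" for k
    by (intro divide_nonneg_nonneg stop_sum_nonneg sum_nonneg out_prob_nonneg) simp
  have lt: "(\<Sum>k<n. ?e k) \<le> exp (- b)" for n
    using err[of n] nn[of n] by (simp add: lessThan_Suc_atMost[symmetric])
  have sm: "summable ?e"
    using nn lt by (rule summableI_nonneg_bounded)
  have e: "err_prob W M enc stop dec = suminf ?e"
    using dec by (rule err_prob_eq)
  show ?thesis
    using code suminf_nonneg[OF sm nn] suminf_le_const[OF sm lt] unfolding e[symmetric] by blast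
qed

end

section \<open>Converse for fixed length\<close>

context regular_channel
begin

text \<open>Per unit mass, \<open>\<Psi>\<close> starts at \<open>- ln M / C\<close>, rises in mean
  by at most 1 per channel use, and ends at about \<open>- ln t / B\<close>; the difference bounds
  the expected time from below. Since \<open>t\<close> only dominates the error, a zero error is
  covered.\<close>

lemma converse_bound:
  assumes code: "is_VLF_code W M N enc stop dec" and M: "M \<ge> 2"
    and C: "capacity W > 0" "capacity W \<le> B"
    and \<delta>: "0 < \<delta>" "\<delta> < 1 / 2" and t: "t > 0" "err_prob W M enc stop dec \<le> t"
  shows "ln (real M) / capacity W * (1 - \<delta> - t) - ln t / B
      - (2 * K + ln (1 / \<delta>) + 1) / B - 2 * ln 2 / capacity W \<le> N"
proof -
  define C where "C = capacity W"
  have C0: "C > 0" and CB: "C \<le> B" using C by (auto simp: C_def)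
  then have B0: "B > 0" by linarith
  let ?S = "{1..M}"
  have dec: "dec ys \<in> ?S" for ys using code by (simp add: is_VLF_code_def)
  have M0: "real M > 0" using M by simp
  have lnM: "ln (real M) \<ge> 0" using M by simp
  define p where "p ys w = out_prob W enc w ys" for ys w
  define T where "T ys = sum (p ys) ?S" for ys
  have T_eq: "T = (\<lambda>ys. \<Sum>w\<in>?S. out_prob W enc w ys)" by (simp add: T_def p_def fun_eq_iff)
  define r where "r ys = sum (p ys) (?S - {dec ys})" for ys
  define U where "U ys = (\<Sum>w\<in>?S. p ys w * log_odds ?S (p ys) w)" for ys
  define H where "H ys = entropy ?S (p ys)" for ys
  define big where "big ys \<longleftrightarrow> (\<exists>w\<in>?S. sum (p ys) (?S - {w}) \<le> \<delta> * T ys)" for ys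
  define \<kappa> where "\<kappa> = (2 * K + ln (1 / \<delta>)) / B + (ln 2 + \<delta> * ln (real M)) / C"
  \<comment> \<open>\<open>\<kappa>\<close> makes \<open>\<Psi>\<close> drop when it switches from entropy to log-odds, so the switch costs no drift.\<close>
  define \<Psi> where "\<Psi> ys = (if survives big ys then - H ys / C else U ys / B - \<kappa> * T ys)" for ys
  have p_snoc: "p (ys @ [y]) = bayes W (\<lambda>w. enc w ys) (p ys) y" for ys y
    unfolding p_def by (rule out_prob_bayes)
  have cases: "weights W ?S (p ys) \<or> (\<forall>w. p ys w = 0)" for ys
    using out_prob_cases[OF M, of enc ys] unfolding p_def by metis
  have dead: "T ys = 0 \<and> r ys = 0 \<and> U ys = 0 \<and> H ys = 0 \<and> \<Psi> ys = 0" if "\<forall>w. p ys w = 0" for ys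
    using that by (simp add: T_def r_def U_def H_def entropy_def \<Psi>_def)
  have pn: "p ys w \<ge> 0" for ys w by (simp add: p_def out_prob_nonneg)
  have T_nonneg: "T ys \<ge> 0" for ys unfolding T_def by (intro sum_nonneg pn)
  have r_le: "r ys \<le> T ys" for ys unfolding T_def r_def by (intro sum_mono2 pn) auto
  have r_nonneg: "r ys \<ge> 0" for ys unfolding r_def by (intro sum_nonneg pn)
  have sumT: "(\<Sum>y\<in>UNIV. T (ys @ [y])) = T ys" for ys
    unfolding T_def p_snoc by (rule sum_bayes)
  have ld: "ln (1 / \<delta>) \<ge> 0" using \<delta> by simp
  have \<kappa>: "ln (1 / \<delta>) / B \<le> \<kappa>"
  proof -
    have "ln (1 / \<delta>) / B \<le> (2 * K + ln (1 / \<delta>)) / B"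
      using B0 K_nonneg by (intro divide_right_mono) auto
    moreover have "(ln 2 + \<delta> * ln (real M)) / C \<ge> 0"
      using C0 lnM \<delta> by simp
    ultimately show ?thesis by (simp add: \<kappa>_def)
  qed

  \<comment> \<open>Drift of the potential, including the switch\<close>
  have drift: "(\<Sum>y\<in>UNIV. \<Psi> (ys @ [y])) - \<Psi> ys \<le> T ys" for ys
    using cases[of ys]
  proof
    assume w: "weights W ?S (p ys)"
    interpret weights W ?S "p ys" by (rule w)
    show ?thesis
    proof (cases "survives big ys")
      case False
      then have "\<not> survives big (ys @ [y])" for y by (simp add: survives_snoc)
      then have "(\<Sum>y\<in>UNIV. \<Psi> (ys @ [y])) = (\<Sum>y\<in>UNIV. U (ys @ [y])) / B - \<kappa> * T ys"
        by (simp add: \<Psi>_def sum_subtractf sum_divide_distrib sum_distrib_left[symmetric] sumT)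
      moreover have "(\<Sum>y\<in>UNIV. U (ys @ [y])) / B \<le> (U ys + B * T ys) / B"
        unfolding U_def T_def p_snoc using B0 by (intro divide_right_mono log_odds_step) auto
      ultimately show ?thesis
        using False B0 by (simp add: \<Psi>_def add_divide_distrib)
    next
      case True
      have "\<not> big ys" using True unfolding survives_def by (metis order_refl take_all)
      then have far: "\<delta> * T ys \<le> sum (p ys) (?S - {w})" if "w \<in> ?S" for w
        using that by (force simp: big_def)
      have "\<Psi> (ys @ [y]) \<le> - H (ys @ [y]) / C" for y
      proof (cases "survives big (ys @ [y])")
        case False
        then have bg: "big (ys @ [y])" using True by (simp add: survives_snoc)
        show ?thesis
        proof (cases "\<exists>x. W x y > 0")
          case False
          then have "W x y = 0" for x using W_nonneg[of x y] by (metis less_le)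
          then have "\<forall>w. p (ys @ [y]) w = 0" by (simp add: p_snoc bayes_def)
          then show ?thesis using dead[of "ys @ [y]"] by simp
        next
          case True
          then obtain x where x: "W x y > 0" by blast
          interpret b: weights W ?S "p (ys @ [y])"
            unfolding p_snoc using x by (rule bayes_weights)
          let ?T = "T (ys @ [y])"
          \<comment> \<open>Just before the switch every message still left a fraction \<delta> of
            the mass to its rivals, and one letter changes this by a bounded factor.\<close>
          have "U (ys @ [y]) \<le> ?T * (2 * K + ln (1 / \<delta>))"
            unfolding U_def T_def p_snoc
            using far \<delta> by (intro average_log_odds_jump[OF x]) (auto simp: T_def)
          then have U': "U (ys @ [y]) / B \<le> ?T * (2 * K + ln (1 / \<delta>)) / B"
            using B0 by (intro divide_right_mono) auto
          obtain v where v: "v \<in> ?S" "sum (p (ys @ [y])) (?S - {v}) \<le> \<delta> * ?T"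
            using bg by (auto simp: big_def)
          have "H (ys @ [y]) \<le> ?T * ln 2 + sum (p (ys @ [y])) (?S - {v}) * ln (real M)"
            unfolding H_def T_def using b.fano[OF v(1)] by simp
          also have "\<dots> \<le> ?T * ln 2 + \<delta> * ?T * ln (real M)"
            using v(2) lnM by (intro add_left_mono mult_right_mono)
          finally have H': "H (ys @ [y]) / C \<le> (?T * ln 2 + \<delta> * ?T * ln (real M)) / C"
            using C0 by (intro divide_right_mono) auto
          have "\<kappa> * ?T = ?T * (2 * K + ln (1 / \<delta>)) / B + (?T * ln 2 + \<delta> * ?T * ln (real M)) / C"
            by (simp add: \<kappa>_def algebra_simps add_divide_distrib)
          then show ?thesis
            using U' H' \<open>\<not> survives big (ys @ [y])\<close> by (simp add: \<Psi>_def)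
        qed
      qed (simp add: \<Psi>_def)
      then have "(\<Sum>y\<in>UNIV. \<Psi> (ys @ [y])) \<le> (\<Sum>y\<in>UNIV. - H (ys @ [y]) / C)"
        by (rule sum_mono)
      also have "\<dots> = - (\<Sum>y\<in>UNIV. H (ys @ [y])) / C"
        by (simp add: sum_negf sum_divide_distrib)
      also have "\<dots> \<le> - (H ys - C * T ys) / C"
        using entropy_step[of "\<lambda>w. enc w ys"] C0 unfolding H_def T_def C_def p_snoc
        by (intro divide_right_mono) auto
      finally show ?thesis using True C0 by (simp add: \<Psi>_def diff_divide_distrib)
    qed
  next
    assume z: "\<forall>w. p ys w = 0"
    then have "\<forall>w. p (ys @ [y]) w = 0" for y by (simp add: p_snoc bayes_def)
    then show ?thesis using dead[OF z] dead by simp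
  qed

  \<comment> \<open>Lower bound on the potential at stopping\<close>
  define \<alpha> where "\<alpha> = - ln t / B - \<kappa> - ln 2 / C"
  \<comment> \<open>The first term is the slope of the tangent to the logarithm at \<open>t\<close>,
    which makes the bound linear in the error mass \<open>r\<close>; the second comes from Fano's
    inequality.\<close>
  define \<beta> where "\<beta> = 1 / (t * B) + ln (real M) / C"
  have \<beta>: "\<beta> \<ge> 0" using t B0 C0 lnM by (simp add: \<beta>_def)
  have lower: "\<alpha> * T ys + - \<beta> * r ys \<le> \<Psi> ys" for ys
    using cases[of ys]
  proof
    assume w: "weights W ?S (p ys)"
    interpret weights W ?S "p ys" by (rule w)
    have Tp: "T ys > 0" using total_pos by (simp add: T_def)
    have rp: "r ys > 0" unfolding r_def using dec by (rule others_pos)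
    let ?l = "ln (r ys / T ys)"
    have main: "T ys * (- ?l - 1) / B - \<kappa> * T ys - H ys / C \<le> \<Psi> ys"
    proof (cases "survives big ys")
      case True
      then have "\<not> big ys" unfolding survives_def by (metis order_refl take_all)
      then have "\<delta> * T ys \<le> r ys" using dec[of ys] by (force simp: big_def r_def)
      then have "\<delta> \<le> r ys / T ys" using Tp by (simp add: pos_le_divide_eq)
      then have "ln \<delta> \<le> ?l" using \<delta> Tp rp by (intro ln_mono) auto
      then have "- ?l - 1 \<le> ln (1 / \<delta>)" using \<delta> by (simp add: ln_div)
      then have "T ys * (- ?l - 1) / B \<le> T ys * (ln (1 / \<delta>) / B)"
        using Tp B0 by (simp add: divide_right_mono)
      also have "\<dots> \<le> T ys * \<kappa>"
        using Tp \<kappa> by (intro mult_left_mono) auto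
      finally show ?thesis using True by (simp add: \<Psi>_def mult.commute)
    next
      case False
      \<comment> \<open>Since \<open>C\<close> is at most \<open>B\<close>, the entropy loss in the
        second phase is covered by the same term \<open>H ys / C\<close> as in the first.\<close>
      have "H ys / B \<le> H ys / C"
        using entropy_nonneg C0 CB by (intro divide_left_mono) (auto simp: H_def)
      moreover have "(T ys * (- ?l - 1) - H ys) / B \<le> U ys / B"
        using average_log_odds_ge[OF dec[of ys]] B0
        unfolding T_def H_def U_def r_def by (intro divide_right_mono) auto
      ultimately show ?thesis using False by (simp add: \<Psi>_def diff_divide_distrib)
    qed
    have "ln (r ys / T ys / t) \<le> r ys / T ys / t - 1"
      using rp Tp t by (intro ln_le_minus_one) simp
    then have "- ln t - r ys / T ys / t \<le> - ?l - 1"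
      using rp Tp t(1) ln_div[of "r ys / T ys" t] by simp
    then have "T ys * (- ln t - r ys / T ys / t) \<le> T ys * (- ?l - 1)"
      using Tp by (intro mult_left_mono) auto
    moreover have "T ys * (- ln t - r ys / T ys / t) = - ln t * T ys - r ys / t"
      using Tp by (simp add: right_diff_distrib)
    ultimately have "(- ln t * T ys - r ys / t) / B \<le> T ys * (- ?l - 1) / B"
      using B0 by (intro divide_right_mono) auto
    moreover have "H ys / C \<le> (T ys * ln 2 + r ys * ln (real M)) / C"
      using fano[OF dec[of ys]] C0 unfolding H_def T_def r_def
      by (intro divide_right_mono) auto
    moreover have "\<alpha> * T ys + - \<beta> * r ys
        = (- ln t * T ys - r ys / t) / B - \<kappa> * T ys - (T ys * ln 2 + r ys * ln (real M)) / C"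
      by (simp add: \<alpha>_def \<beta>_def algebra_simps add_divide_distrib diff_divide_distrib)
    ultimately show ?thesis using main by linarith
  next
    assume z: "\<forall>w. p ys w = 0"
    then show ?thesis using dead[OF z] by simp
  qed
  \<comment> \<open>A crude constant suffices on strings that have not stopped, because their mass
    tends to 0.\<close>
  define D where "D = \<bar>\<alpha>\<bar> + \<beta>"
  have lower': "- D * T ys \<le> \<Psi> ys" for ys
  proof -
    have "- \<bar>\<alpha>\<bar> * T ys \<le> \<alpha> * T ys" using T_nonneg by (intro mult_right_mono) auto
    moreover have "\<beta> * r ys \<le> \<beta> * T ys" using r_le \<beta> by (intro mult_left_mono) auto
    ultimately show ?thesis using lower[of ys] by (simp add: D_def algebra_simps)
  qed

  \<comment> \<open>Passage to the limit in the truncation time\<close>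
  define q where "q n = prob_tau_gt W M enc stop n" for n
  have q_eq: "surv_sum stop n T = real M * q n" for n
    using M0 by (simp add: q_def prob_tau_gt_eq T_eq)
  have q_nonneg: "q n \<ge> 0" for n
    using q_eq[of n] surv_sum_nonneg[of T stop n] T_nonneg M0 by (simp add: zero_le_mult_iff)
  have q_sum: "(\<Sum>k<n. q k) \<le> N" for n
  proof -
    have "ennreal (\<Sum>k<n. q k) = (\<Sum>k<n. ennreal (q k))" using q_nonneg by simp
    also have "\<dots> \<le> exp_tau W M enc stop"
      unfolding exp_tau_def q_def by (intro sum_le_suminf) auto
    also have "\<dots> \<le> ennreal N" using code by (simp add: is_VLF_code_def)
    finally show ?thesis using code by (simp add: is_VLF_code_def)
  qed
  have "summable q" using q_nonneg q_sum by (rule summableI_nonneg_bounded)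
  then have q_lim: "q \<longlonglongrightarrow> 0" by (rule summable_LIMSEQ_zero)
  have stopT: "(\<Sum>k\<le>n. stop_sum stop k T) = real M * (1 - q n)" for n
    using stopping_mass[where stop = stop and n = n and M = M and enc = enc] q_eq[of n]
    unfolding T_eq[symmetric] by (simp add: algebra_simps)
  let ?e = "\<lambda>k. stop_sum stop k r / real M"
  have e_nonneg: "?e k \<ge> 0" for k
    using r_nonneg by (intro divide_nonneg_nonneg stop_sum_nonneg) auto
  have "(\<Sum>k<n. ?e k) \<le> 1" for n
  proof -
    have "(\<Sum>k<n. ?e k) \<le> (\<Sum>k\<le>n. ?e k)"
      using e_nonneg by (intro sum_mono2) auto
    also have "\<dots> \<le> (\<Sum>k\<le>n. stop_sum stop k T / real M)"
      using r_le by (intro sum_mono divide_right_mono stop_sum_mono) auto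
    also have "\<dots> \<le> 1"
      using stopT[of n] q_nonneg[of n] M0 by (simp add: sum_divide_distrib[symmetric])
    finally show ?thesis .
  qed
  then have e_sum: "summable ?e" by (rule summableI_nonneg_bounded[OF e_nonneg])
  have "err_prob W M enc stop dec = suminf ?e"
    unfolding r_def p_def using dec by (rule err_prob_eq)
  then have e_le: "(\<Sum>k\<le>n. ?e k) \<le> t" for n
    using sum_le_suminf[OF e_sum, of "{..n}"] e_nonneg t by simp

  have bound: "- D * q n + \<alpha> * (1 - q n) - \<beta> * t \<le> - ln (real M) / C + N" for n
  proof -
    have "surv_sum stop n (\<lambda>ys. - D * T ys) + (\<Sum>k\<le>n. stop_sum stop k (\<lambda>ys. \<alpha> * T ys + - \<beta> * r ys))
        \<le> surv_sum stop n \<Psi> + (\<Sum>k\<le>n. stop_sum stop k \<Psi>)"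
      using lower lower' by (intro add_mono sum_mono surv_sum_mono stop_sum_mono) auto
    also have "\<dots> \<le> \<Psi> [] + (\<Sum>k<n. surv_sum stop k T)"
      using drift by (rule optional_stopping_le)
    also have "\<Psi> [] = - real M * ln (real M) / C"
    proof -
      \<comment> \<open>With \<delta> below one half and at least two messages, the uniform prior
        lies in the entropy phase.\<close>
      have "real M - 1 > \<delta> * real M"
      proof -
        have "\<delta> * real M < 1 / 2 * real M" using \<delta> M0 by (intro mult_strict_right_mono) auto
        moreover have "real M \<ge> 2" using M by simp
        ultimately show ?thesis by linarith
      qed
      then have "\<not> big []"
        using M by (auto simp: big_def T_def p_def out_prob_Nil of_nat_diff)
      then show ?thesis
        by (simp add: \<Psi>_def survives_Nil H_def entropy_def p_def out_prob_Nil)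
    qed
    also have "(\<Sum>k<n. surv_sum stop k T) = real M * (\<Sum>k<n. q k)"
      by (simp add: q_eq sum_distrib_left)
    also have "\<dots> \<le> real M * N" using q_sum M0 by (intro mult_left_mono) auto
    finally have "- D * (real M * q n) + (\<alpha> * (real M * (1 - q n)) - \<beta> * (\<Sum>k\<le>n. stop_sum stop k r))
        \<le> - real M * ln (real M) / C + real M * N"
      unfolding surv_sum_cmult stop_sum_add stop_sum_cmult sum.distrib sum_distrib_left[symmetric]
        q_eq stopT by simp
    moreover have "\<beta> * (\<Sum>k\<le>n. stop_sum stop k r) \<le> \<beta> * (real M * t)"
      using e_le[of n] M0 \<beta>
      by (intro mult_left_mono) (auto simp: sum_divide_distrib[symmetric] pos_divide_le_eq mult.commute)
    ultimately have "real M * (- D * q n + \<alpha> * (1 - q n) - \<beta> * t) \<le> real M * (- ln (real M) / C + N)"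
      by (simp add: algebra_simps)
    then show ?thesis using M0 by simp
  qed
  have "(\<lambda>n. - D * q n + \<alpha> * (1 - q n) - \<beta> * t) \<longlonglongrightarrow> - D * 0 + \<alpha> * (1 - 0) - \<beta> * t"
    by (intro tendsto_intros q_lim)
  then have "- D * 0 + \<alpha> * (1 - 0) - \<beta> * t \<le> - ln (real M) / C + N"
    by (rule LIMSEQ_le_const2) (use bound in auto)
  moreover have "\<beta> * t = 1 / B + t * ln (real M) / C"
    using t B0 by (simp add: \<beta>_def field_simps)
  ultimately show ?thesis
    unfolding C_def[symmetric] \<alpha>_def \<kappa>_def
    by (simp add: algebra_simps add_divide_distrib diff_divide_distrib)
qed

end

section \<open>Moderate deviations\<close>

lemma neg_ln_divide: "p \<noteq> 0 \<Longrightarrow> x > 0 \<Longrightarrow> neg_ln p / ereal x = ereal (- ln p / x)"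
  by (simp add: neg_ln_def)

context regular_channel
begin

lemma achievable_md_below:
  fixes \<rho> :: "real \<Rightarrow> real"
  assumes P: "is_dist P" "mutual_info P W = capacity W" and C0: "capacity W > 0"
    and \<rho>0: "\<And>N. N > 0 \<Longrightarrow> \<rho> N > 0" and \<rho>_lim: "(\<rho> \<longlongrightarrow> 0) at_top"
    and \<rho>_sqrt: "filterlim (\<lambda>N. \<rho> N * sqrt N) at_top at_top"
    and E: "0 < E" "E < B / capacity W"
  shows "achievable_md W \<rho> E"
proof -
  define C where "C = capacity W"
  have C: "C > 0" "mutual_info P W = C" using C0 P by (simp_all add: C_def)
  have B: "B > 0" using mutual_info_le_B[OF P(1)] C by linarith
  \<comment> \<open>Backing off from capacity by \<open>\<rho> N\<close> frees time
    \<open>N * \<rho> N / C\<close>, and the target error costs time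
    \<open>E * (N * \<rho> N) / B\<close>; \<eta> is the surplus per unit of
    \<open>N * \<rho> N\<close>.\<close>
  define \<eta> where "\<eta> = 1 / C - E / B"
  have \<eta>: "\<eta> > 0" using E C B by (simp add: \<eta>_def C_def[symmetric] field_simps)
  define c1 where "c1 = 1 + K\<^sup>2 / C"
  have c1: "c1 \<ge> 1" using C by (simp add: c1_def)
  \<comment> \<open>Collects, in units of \<open>sqrt N\<close>, the drift loss, the cost of
    \<open>a\<close> and \<open>R\<close>, the rounding of \<open>M\<close> and the
    overshoot.\<close>
  define c2 where "c2 = c1 + 2 / C + ln 2 / C + K / B"
  define large where "large N \<longleftrightarrow> N > 0 \<and> sqrt N > c1 \<and> \<rho> N < C \<and> \<rho> N * sqrt N \<ge> c2 / \<eta>" for N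
  have ev: "eventually large at_top"
  proof -
    have "eventually (\<lambda>N :: real. N > 0) at_top" by (rule eventually_gt_at_top)
    moreover have "eventually (\<lambda>N. sqrt N > c1) at_top"
      using sqrt_at_top by (auto simp: filterlim_at_top_dense)
    moreover have "eventually (\<lambda>N. \<rho> N < C) at_top"
      using order_tendstoD(2)[OF \<rho>_lim C(1)] .
    moreover have "eventually (\<lambda>N. \<rho> N * sqrt N \<ge> c2 / \<eta>) at_top"
      using \<rho>_sqrt by (auto simp: filterlim_at_top)
    ultimately show ?thesis unfolding large_def by eventually_elim blast
  qed
  have "\<exists>M enc stop dec. is_VLF_code W M N enc stop dec \<and> ln (real M) / N \<ge> C - \<rho> N
      \<and> (large N \<longrightarrow> 0 \<le> err_prob W M enc stop dec \<and> err_prob W M enc stop dec \<le> exp (- (E * (N * \<rho> N))))"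
    if N: "N > 0" for N
  proof -
    let ?x = "exp (N * (C - \<rho> N))"
    \<comment> \<open>Rounding up preserves the rate; for large \<open>N\<close> it at most doubles
      \<open>M\<close>, which costs \<open>ln 2\<close>.\<close>
    define M where "M = nat \<lceil>?x\<rceil>"
    have M_ge: "real M \<ge> ?x" unfolding M_def by linarith
    then have "real M > 0" using exp_gt_zero[of "N * (C - \<rho> N)"] by linarith
    then have "ln ?x \<le> ln (real M)" using M_ge by (intro ln_mono) auto
    then have rate: "ln (real M) / N \<ge> C - \<rho> N"
      using N by (simp add: pos_le_divide_eq mult.commute)
    have M1: "M \<ge> 1" using \<open>real M > 0\<close> by simp
    show ?thesis
    proof (cases "large N")
      case False
      \<comment> \<open>Outside the asymptotic range a code that stops at once meets the time and
        rate constraints; its error does not affect the limits.\<close>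
      have "surv_sum (\<lambda>_. True) n F = 0" for n and F :: "'y list \<Rightarrow> real"
        unfolding surv_sum_def survives_def by (intro sum.neutral) auto
      then have "exp_tau W M (\<lambda>_ _. undefined) (\<lambda>_. True) = 0"
        by (simp add: exp_tau_def prob_tau_gt_eq)
      then have "is_VLF_code W M N (\<lambda>_ _. undefined) (\<lambda>_. True) (\<lambda>_. 1)"
        using M1 N by (simp add: is_VLF_code_def)
      then show ?thesis using rate False by blast
    next
      case True
      define s where "s = sqrt N"
      have s: "s > c1" "s > 0" "s \<ge> 1" using True c1 unfolding s_def large_def by linarith+
      have N_s: "N = s * s" using N by (simp add: s_def)
      have pos: "N * (C - \<rho> N) > 0" using True by (simp add: large_def)
      then have x1: "?x > 1" by simp
      then have M2: "M \<ge> 2" using M_ge by linarith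
      have "real M \<le> 2 * ?x" using x1 unfolding M_def by linarith
      then have "ln (real M) \<le> ln (2 * ?x)" using M2 by (intro ln_mono) auto
      then have lnM: "ln (real M) \<le> N * (C - \<rho> N) + ln 2" by (simp add: ln_mult)
      have "exp (- s) \<le> 1 / s"
      proof -
        have "s \<le> exp s" using exp_ge_add_one_self[of s] by linarith
        then have "1 / exp s \<le> 1 / s" using s(2) by (intro divide_left_mono) auto
        then show ?thesis by (simp add: exp_minus inverse_eq_divide)
      qed
      then have loss: "exp (- s) + K\<^sup>2 / (C * s) \<le> c1 / s"
        by (simp add: c1_def add_divide_distrib)
      have "c2 / \<eta> \<le> \<rho> N * s" using True by (simp add: large_def s_def)
      then have "c2 \<le> \<eta> * (\<rho> N * s)" using \<eta> by (simp add: field_simps)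
      then have "c2 * s \<le> \<eta> * (\<rho> N * s) * s" using s by (intro mult_right_mono) auto
      then have gain: "c2 * s \<le> N * \<rho> N / C - E * (N * \<rho> N) / B"
        by (simp add: \<eta>_def N_s algebra_simps)
      have "(ln 2 / C + K / B) * 1 \<le> (ln 2 / C + K / B) * s"
        using s C B K_nonneg by (intro mult_left_mono) auto
      then have "ln 2 / C + K / B + 2 * s / C + c1 * s \<le> c2 * s"
        by (simp add: c2_def algebra_simps)
      moreover have "ln (real M) / C \<le> (N * (C - \<rho> N) + ln 2) / C"
        using lnM C by (intro divide_right_mono) auto
      moreover have "(N * (C - \<rho> N) + ln 2) / C = N - N * \<rho> N / C + ln 2 / C"
        using C by (simp add: add_divide_distrib right_diff_distrib diff_divide_distrib)
      ultimately have "ln (real M) / C + (E * (N * \<rho> N) + K) / B + (s + s) / C \<le> N - c1 * s"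
        using gain by (simp add: add_divide_distrib)
      also have "\<dots> = (1 - c1 / s) * N" using s by (simp add: N_s algebra_simps)
      also have "\<dots> \<le> (1 - exp (- s) - K\<^sup>2 / (C * s)) * N"
        using loss N by (intro mult_right_mono) auto
      finally have len: "ln (real M) / C + (E * (N * \<rho> N) + K) / B + (s + s) / C
        \<le> (1 - exp (- s) - K\<^sup>2 / (C * s)) * N" .
      have "c1 / s < 1" using s by simp
      then have "exp (- s) + K\<^sup>2 / (C * s) < 1" using loss by linarith
      then have "\<exists>enc stop dec. is_VLF_code W M N enc stop dec \<and> 0 \<le> err_prob W M enc stop dec
          \<and> err_prob W M enc stop dec \<le> exp (- (E * (N * \<rho> N)))"
        using s E N \<rho>0[OF N] by (intro VLF_code_exists[OF P(1) C(2,1) M2 _ _ _ N _ len]) auto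
      then show ?thesis using rate by blast
    qed
  qed
  then have "\<forall>N. \<exists>M enc stop dec. N > 0 \<longrightarrow> is_VLF_code W M N enc stop dec \<and> ln (real M) / N \<ge> C - \<rho> N
      \<and> (large N \<longrightarrow> 0 \<le> err_prob W M enc stop dec \<and> err_prob W M enc stop dec \<le> exp (- (E * (N * \<rho> N))))"
    by blast
  then obtain Mf enc stop dec where
    codes: "\<And>N. N > 0 \<Longrightarrow> is_VLF_code W (Mf N) N (enc N) (stop N) (dec N) \<and> ln (real (Mf N)) / N \<ge> C - \<rho> N
      \<and> (large N \<longrightarrow> 0 \<le> err_prob W (Mf N) (enc N) (stop N) (dec N)
          \<and> err_prob W (Mf N) (enc N) (stop N) (dec N) \<le> exp (- (E * (N * \<rho> N))))"
    unfolding choice_iff by blast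
  let ?err = "\<lambda>N. err_prob W (Mf N) (enc N) (stop N) (dec N)"
  have err: "eventually (\<lambda>N. N > 0 \<and> 0 \<le> ?err N \<and> ?err N \<le> exp (- (E * (N * \<rho> N)))) at_top"
    using ev by eventually_elim (use codes in \<open>auto simp: large_def\<close>)
  have prod: "filterlim (\<lambda>N. sqrt N * (\<rho> N * sqrt N)) at_top at_top"
    using sqrt_at_top \<rho>_sqrt by (rule filterlim_at_top_mult_at_top)
  have "eventually (\<lambda>N. sqrt N * (\<rho> N * sqrt N) = N * \<rho> N) at_top"
    using eventually_gt_at_top[of "0 :: real"] by eventually_elim simp
  then have "filterlim (\<lambda>N. N * \<rho> N) at_top at_top"
    by (rule filterlim_cong[OF refl refl, THEN iffD1, OF _ prod])
  then have "filterlim (\<lambda>N. E * (N * \<rho> N)) at_top at_top"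
    using E by (intro filterlim_tendsto_pos_mult_at_top[OF tendsto_const]) auto
  then have "filterlim (\<lambda>N. - (E * (N * \<rho> N))) at_bot at_top"
    by (simp add: filterlim_uminus_at_top)
  then have exp0: "((\<lambda>N. exp (- (E * (N * \<rho> N)))) \<longlongrightarrow> 0) at_top"
    by (rule filterlim_compose[OF exp_at_bot])
  have lim: "(?err \<longlongrightarrow> 0) at_top"
    by (rule tendsto_sandwich[OF _ _ tendsto_const exp0]) (use err in \<open>auto elim: eventually_mono\<close>)
  have "Liminf at_top (\<lambda>N. neg_ln (?err N) / ereal (N * \<rho> N)) \<ge> ereal E"
  proof (rule Liminf_bounded)
    show "eventually (\<lambda>N. ereal E \<le> neg_ln (?err N) / ereal (N * \<rho> N)) at_top"
      using err
    proof eventually_elim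
      case (elim N)
      then have pos: "N * \<rho> N > 0" using \<rho>0 by simp
      show ?case
      proof (cases "?err N = 0")
        case False
        then have "ln (?err N) \<le> ln (exp (- (E * (N * \<rho> N))))"
          using elim by (intro ln_mono) auto
        then have "ln (?err N) \<le> - (E * (N * \<rho> N))" by simp
        then have "E \<le> - ln (?err N) / (N * \<rho> N)"
          using pos by (simp only: pos_le_divide_eq)
        then show ?thesis by (simp only: neg_ln_divide[OF False pos] ereal_less_eq)
      qed (use pos in \<open>simp add: neg_ln_def\<close>)
    qed
  qed
  then show ?thesis
    unfolding achievable_md_def C_def[symmetric]
    using codes lim E by (intro conjI exI[of _ Mf] exI[of _ enc] exI[of _ stop] exI[of _ dec]) auto
qed

lemma achievable_md_le:
  fixes \<rho> :: "real \<Rightarrow> real"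
  assumes C0: "capacity W > 0" "capacity W \<le> B"
    and \<rho>0: "\<And>N. N > 0 \<Longrightarrow> \<rho> N > 0" and \<rho>_lim: "(\<rho> \<longlongrightarrow> 0) at_top"
    and \<rho>_sqrt: "filterlim (\<lambda>N. \<rho> N * sqrt N) at_top at_top"
    and ach: "achievable_md W \<rho> E"
  shows "E \<le> B / capacity W"
proof (rule ccontr)
  define C where "C = capacity W"
  have C: "C > 0" and B: "B > 0" using C0 by (simp_all add: C_def)
  assume "\<not> E \<le> B / capacity W"
  \<comment> \<open>A value strictly inside the gap turns the bound on the limit inferior into an
    eventual strict one, so a single large \<open>N\<close> gives the contradiction.\<close>
  then obtain E' where E': "B / C < E'" "E' < E"
    using dense[of "B / C" E] by (auto simp: C_def)
  have E'0: "E' > 0" using E'(1) B C by (meson divide_pos_pos less_trans)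
  define \<eta> where "\<eta> = E' / B - 1 / C"
  have \<eta>: "\<eta> > 0" using E'(1) B C by (simp add: \<eta>_def field_simps)
  obtain Mf enc stop dec where
    codes: "\<And>N. N > 0 \<Longrightarrow> is_VLF_code W (Mf N) N (enc N) (stop N) (dec N)"
    and rate: "\<And>N. N > 0 \<Longrightarrow> ln (real (Mf N)) / N \<ge> C - \<rho> N"
    and li: "Liminf at_top (\<lambda>N. neg_ln (err_prob W (Mf N) (enc N) (stop N) (dec N)) / ereal (N * \<rho> N)) \<ge> ereal E"
    using ach unfolding achievable_md_def C_def[symmetric] by blast
  let ?err = "\<lambda>N. err_prob W (Mf N) (enc N) (stop N) (dec N)"
  \<comment> \<open>Collects all corrections in units of \<open>sqrt N\<close>; the logarithm from
    the choice \<open>1 / N\<close> of \<delta> is absorbed because \<open>ln N\<close> is at most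
    \<open>2 * sqrt N\<close>.\<close>
  define c where "c = 2 + 2 * K / B + 3 / B + 2 * ln 2 / C"
  have "ereal E' < Liminf at_top (\<lambda>N. neg_ln (?err N) / ereal (N * \<rho> N))"
    using li by (rule less_le_trans[rotated]) (simp add: E'(2))
  then have "eventually (\<lambda>N. ereal E' < neg_ln (?err N) / ereal (N * \<rho> N)) at_top"
    by (rule less_LiminfD)
  moreover have "eventually (\<lambda>N. \<rho> N < C) at_top"
    using \<rho>_lim C by (rule order_tendstoD)
  moreover have "eventually (\<lambda>N. \<rho> N * sqrt N > max (2 / E') (c / \<eta>)) at_top"
    using \<rho>_sqrt unfolding filterlim_at_top_dense by blast
  moreover have "eventually (\<lambda>N :: real. N > 2) at_top" by (rule eventually_gt_at_top)
  ultimately have "eventually (\<lambda>N. ereal E' < neg_ln (?err N) / ereal (N * \<rho> N) \<and> \<rho> N < C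
      \<and> \<rho> N * sqrt N > max (2 / E') (c / \<eta>) \<and> N > 2) at_top"
    by eventually_elim blast
  then obtain N where N: "ereal E' < neg_ln (?err N) / ereal (N * \<rho> N)" "\<rho> N < C"
      "\<rho> N * sqrt N > max (2 / E') (c / \<eta>)" "N > 2"
    unfolding eventually_at_top_linorder by blast
  define s where "s = sqrt N"
  have N_s: "N = s * s" and s1: "s \<ge> 1" using N(4) by (simp_all add: s_def)
  have \<rho>N: "\<rho> N > 0" using \<rho>0 N(4) by simp
  have x0: "N * \<rho> N > 0" using \<rho>N N(4) by simp
  have lnN: "ln N \<le> 2 * s"
  proof -
    have "ln N = 2 * ln s" using s1 by (simp add: N_s ln_mult)
    then show ?thesis using ln_le_minus_one[of s] s1 by simp
  qed
  \<comment> \<open>The error itself may be 0, so the converse is applied with this positive upper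
    bound.\<close>
  define t where "t = exp (- (E' * (N * \<rho> N)))"
  have err_t: "?err N \<le> t"
  proof (cases "?err N > 0")
    case True
    then have "E' < - ln (?err N) / (N * \<rho> N)"
      using N(1) neg_ln_divide[OF _ x0, of "?err N"] by simp
    then have "ln (?err N) < - (E' * (N * \<rho> N))" using x0 by (simp only: pos_less_divide_eq)
    then have "exp (ln (?err N)) < t" unfolding t_def by (simp only: exp_less_cancel_iff)
    then show ?thesis using True by simp
  next
    case False
    then show ?thesis unfolding t_def using exp_gt_zero[of "- (E' * (N * \<rho> N))"] by linarith
  qed
  have gain: "\<rho> N * s > 2 / E'" "\<rho> N * s > c / \<eta>" using N(3) by (simp_all add: s_def)
  \<comment> \<open>Makes the factor \<open>1 - 1 / N - t\<close> in the converse cost at most 2 in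
    total.\<close>
  have Nt: "N * t \<le> 1"
  proof -
    have "2 < E' * (\<rho> N * s)" using gain(1) E'0 by (simp add: field_simps)
    then have "2 * s \<le> E' * (\<rho> N * s) * s" using s1 by (intro mult_right_mono) auto
    then have "ln N \<le> E' * (N * \<rho> N)" using lnN by (simp add: N_s algebra_simps)
    then have "exp (ln N) * t \<le> exp (E' * (N * \<rho> N)) * t"
      by (intro mult_right_mono) (auto simp: t_def)
    then show ?thesis using N(4) by (simp add: t_def exp_add[symmetric])
  qed
  have lnM: "ln (real (Mf N)) \<ge> N * (C - \<rho> N)"
    using rate[of N] N(4) by (simp add: pos_le_divide_eq mult.commute)
  have "N * (C - \<rho> N) > 0" using N by simp
  then have "ln (real (Mf N)) > 0" using lnM by linarith
  then have M: "Mf N \<ge> 2"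
    by (cases "Mf N = 0"; cases "Mf N = 1") auto
  have bound: "ln (real (Mf N)) / C * (1 - 1 / N - t) - ln t / B
      - (2 * K + ln (1 / (1 / N)) + 1) / B - 2 * ln 2 / C \<le> N"
    unfolding C_def
    using converse_bound[OF codes[of N] M C0, of "1 / N" t] N(4) err_t by (simp add: t_def)
  have t_le: "t \<le> 1 / N" using Nt N(4) by (simp add: pos_le_divide_eq mult.commute)
  have "1 / N < 1 / 2" using N(4) by (intro divide_strict_left_mono) auto
  then have q: "1 - 1 / N - t \<ge> 0" using t_le by linarith
  have "N * (1 - \<rho> N / C) * (1 - 1 / N - t) \<le> ln (real (Mf N)) / C * (1 - 1 / N - t)"
  proof (rule mult_right_mono[OF _ q])
    have "N * (C - \<rho> N) / C \<le> ln (real (Mf N)) / C" using lnM C by (intro divide_right_mono) auto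
    then show "N * (1 - \<rho> N / C) \<le> ln (real (Mf N)) / C"
      using C by (simp add: field_simps)
  qed
  moreover have "N - N * \<rho> N / C - 2 \<le> N * (1 - \<rho> N / C) * (1 - 1 / N - t)"
  proof -
    have "N * (1 / N + t) \<le> 2" using Nt N(4) by (simp add: distrib_left)
    moreover have "(1 - \<rho> N / C) * (N * (1 / N + t)) \<le> 1 * (N * (1 / N + t))"
      using \<rho>N C N(4) by (intro mult_right_mono) (auto simp: t_def)
    ultimately have "(1 - \<rho> N / C) * (N * (1 / N + t)) \<le> 2" by linarith
    moreover have "N * (1 - \<rho> N / C) * (1 - 1 / N - t)
        = N - N * \<rho> N / C - (1 - \<rho> N / C) * (N * (1 / N + t))"
      by (simp add: algebra_simps add_divide_distrib)
    ultimately show ?thesis by linarith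
  qed
  moreover have "- ln t / B = E' * (N * \<rho> N) / B" by (simp add: t_def)
  moreover have "(2 * K + ln (1 / (1 / N)) + 1) / B \<le> (2 * K + 2 * s + 1) / B"
    using lnN B by (intro divide_right_mono) auto
  ultimately have "E' * (N * \<rho> N) / B - N * \<rho> N / C \<le> 2 + (2 * K + 2 * s + 1) / B + 2 * ln 2 / C"
    using bound by linarith
  also have "\<dots> \<le> c * s"
  proof -
    have "(2 + 2 * K / B + 1 / B + 2 * ln 2 / C) * 1 \<le> (2 + 2 * K / B + 1 / B + 2 * ln 2 / C) * s"
      using s1 B C K_nonneg by (intro mult_left_mono) auto
    moreover have "3 / B = 1 / B + 2 / B" by (simp add: add_divide_distrib[symmetric])
    then have "c * s = (2 + 2 * K / B + 1 / B + 2 * ln 2 / C) * s + 2 * s / B"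
      by (simp add: c_def distrib_right)
    ultimately show ?thesis by (simp add: add_divide_distrib)
  qed
  also have "\<dots> < \<eta> * (\<rho> N * s) * s"
    using gain(2) \<eta> s1 by (intro mult_strict_right_mono) (auto simp: field_simps)
  also have "\<dots> = E' * (N * \<rho> N) / B - N * \<rho> N / C"
    by (simp add: \<eta>_def N_s algebra_simps)
  finally show False by simp
qed

end

theorem theorem1:
  fixes W :: "'x::finite \<Rightarrow> 'y::finite \<Rightarrow> real" and \<rho> :: "real \<Rightarrow> real"
  assumes "channel W"
    and "capacity W > 0"
    and "\<exists>P. is_dist P \<and> mutual_info P W = capacity W \<and> (\<forall>x. P x > 0)"
    and "maxKL W < \<infinity>"
    and "\<forall>N>0. \<rho> N > 0"
    and "(\<rho> \<longlongrightarrow> 0) at_top"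
    and "filterlim (\<lambda>N. \<rho> N * sqrt N) at_top at_top"
  shows "optimal_md W \<rho> = maxKL W / ereal (capacity W)"
proof -
  interpret regular_channel W
    using assms(1,4) by (rule regular_channelI)
  obtain P where P: "is_dist P" "mutual_info P W = capacity W"
    using assms(3) by blast
  have CB: "capacity W \<le> B" using mutual_info_le_B[OF P(1)] P(2) by simp
  have pos: "B / capacity W > 0" using CB assms(2) by simp
  have "Sup (ereal ` {E. achievable_md W \<rho> E}) = ereal (B / capacity W)"
  proof (rule antisym)
    show "Sup (ereal ` {E. achievable_md W \<rho> E}) \<le> ereal (B / capacity W)"
      using achievable_md_le[OF assms(2) CB _ assms(6,7)] assms(5)
      by (intro SUP_least) auto
    \<comment> \<open>The construction reaches every exponent strictly between 0 and the target, and
      density carries this to the supremum.\<close>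
    show "ereal (B / capacity W) \<le> Sup (ereal ` {E. achievable_md W \<rho> E})"
    proof (rule dense_le_bounded[of 0])
      show "0 < ereal (B / capacity W)" using pos by simp
      fix z :: ereal assume z: "0 < z" "z < ereal (B / capacity W)"
      then obtain E where E: "z = ereal E" by (cases z) auto
      then have "achievable_md W \<rho> E"
        using z assms(5) by (intro achievable_md_below[OF P assms(2) _ assms(6,7)]) auto
      then show "z \<le> Sup (ereal ` {E. achievable_md W \<rho> E})"
        unfolding E by (intro SUP_upper) auto
    qed
  qed
  then show ?thesis
    using assms(2) by (simp add: optimal_md_def maxKL_eq)
qed

end
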